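(* Let $X$ be a compact Hausdorff space, $\Delta_1\subset X$ clopen, $\alpha:\Delta_1\to X$ continuous with open image $\Delta_{-1}$, $\mathcal{A}=C(X)$, and let $\delta:\mathcal{A}\to\mathcal{A}$ be the endomorphism $\delta(a)=a\circ\alpha$ on $\Delta_1$, $\delta(a)=0$ off $\Delta_1$. Let $(\pi,U,H)\in\mathrm{CovFaithRep}(\mathcal{A},\delta)$ and let $\widetilde X$ be the $\alpha$-extension of $X$. Then $$C^*\Big(\bigcup_{n=0}^\infty U^{*n}\pi(\mathcal{A})U^n\Big)\cong C(\widetilde X).$$ Moreover, this isomorphism maps an operator of the form $\pi(a_0)+U^*\pi(a_1)U+\dots+U^{*N}\pi(a_N)U^N$, where $a_0,a_1,\dots,a_N\in\mathcal{A}$, onto the function $b\in C(\widetilde X)$ such that $$b(\widetilde x)=a_0(x_0)+a_1(x_1)+\dots+a_N(x_N),$$ where $\widetilde x=(x_0,x_1,\dots)\in\widetilde X$ and we set $a_n(x_n)=0$ whenever $x_n=0$.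
   Context: For $n\ge1$, $\Delta_n$ is the domain of $\alpha^n$; $\Delta_0=X$. For $K\subset X$, $C_K(X)$ denotes the continuous functions on $X$ vanishing outside $K$. $C^*(S)$ is the $C^*$-algebra generated by $S\subset L(H)$. Covariant faithful representation: a triple $(\pi,U,H)$ where $\pi:\mathcal{A}\to L(H)$ is a faithful representation on a Hilbert space $H$ and $U\in L(H)$ is a partial isometry with initial space $\pi(C_{\Delta_{-1}}(X))H$ and final space $\pi(C_{\Delta_1}(X))H$, such that $U\pi(a)U^*=\pi(\delta(a))$ for $a\in\mathcal{A}$. $\mathrm{CovFaithRep}(\mathcal{A},\delta)$ is the set of these. $\alpha$-extension: adjoin to $X$ an isolated point, denoted $0$. $\widetilde X=\bigcup_{N\ge0}X_N\cup X_\infty\subset\prod_{n=0}^\infty(X\cup\{0\})$ with the topology induced from the product topology, where $X_N=\{(x_0,\dots,x_N,0,0,\dots):x_n\in\Delta_n,\ x_N\notin\Delta_{-1},\ \alpha(x_n)=x_{n-1}\text{ for }1\le n\le N\}$ and $X_\infty=\{(x_0,x_1,\dots):x_n\in\Delta_n,\ \alpha(x_n)=x_{n-1}\text{ for }n\ge1\}$. *)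

theory Defs
  imports "HOL-Analysis.Analysis"
begin

section \<open>Complex Hilbert spaces and their bounded operators\<close>

text \<open>The inner product is linear in the first argument.\<close>

class complex_hilbert_space = banach +
  fixes scaleC :: "complex \<Rightarrow> 'a \<Rightarrow> 'a"  (infixr \<open>*\<^sub>C\<close> 75)
    and cinner :: "'a \<Rightarrow> 'a \<Rightarrow> complex"
  assumes scaleR_eq_scaleC: "scaleR r x = scaleC (complex_of_real r) x"
    and scaleC_add_right: "scaleC c (x + y) = scaleC c x + scaleC c y"
    and scaleC_add_left: "scaleC (c + d) x = scaleC c x + scaleC d x"
    and scaleC_scaleC: "scaleC c (scaleC d x) = scaleC (c * d) x"
    and scaleC_one: "scaleC 1 x = x"
    and cinner_commute: "cinner x y = cnj (cinner y x)"
    and cinner_add_left: "cinner (x + y) z = cinner x z + cinner y z"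
    and cinner_scaleC_left: "cinner (scaleC c x) y = c * cinner x y"
    and cinner_self_nonneg: "0 \<le> Re (cinner x x)"
    and cinner_self_eq_0_iff: "cinner x x = 0 \<longleftrightarrow> x = 0"
    and norm_eq_sqrt_cinner: "norm x = sqrt (Re (cinner x x))"

lemma norm_scaleC: "norm (c *\<^sub>C x) = cmod c * norm (x :: 'h::complex_hilbert_space)"
proof -
  have "cinner (c *\<^sub>C x) (c *\<^sub>C x) = c * cinner x (c *\<^sub>C x)"
    by (rule cinner_scaleC_left)
  also have "cinner x (c *\<^sub>C x) = cnj (cinner (c *\<^sub>C x) x)"
    by (rule cinner_commute)
  also have "\<dots> = cnj c * cnj (cinner x x)"
    by (simp add: cinner_scaleC_left)
  also have "cnj (cinner x x) = cinner x x"
    using cinner_commute[of x x] by simp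
  finally have "cinner (c *\<^sub>C x) (c *\<^sub>C x) = of_real ((cmod c)\<^sup>2) * cinner x x"
    by (simp only: complex_norm_square mult.assoc)
  then have "Re (cinner (c *\<^sub>C x) (c *\<^sub>C x)) = (cmod c)\<^sup>2 * Re (cinner x x)"
    by simp
  then show ?thesis
    by (simp add: norm_eq_sqrt_cinner real_sqrt_mult)
qed

lemma bounded_linear_scaleC:
  "bounded_linear (\<lambda>x :: 'h::complex_hilbert_space. c *\<^sub>C x)"
proof (rule bounded_linear_intro[where K = "cmod c"])
  fix x y :: 'h and r :: real
  show "c *\<^sub>C (x + y) = c *\<^sub>C x + c *\<^sub>C y"
    by (rule scaleC_add_right)
  show "c *\<^sub>C (r *\<^sub>R x) = r *\<^sub>R (c *\<^sub>C x)"
    by (simp add: scaleR_eq_scaleC scaleC_scaleC mult.commute)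
  show "norm (c *\<^sub>C x) \<le> norm x * cmod c"
    by (simp add: norm_scaleC mult.commute)
qed

text \<open>\<open>'h \<Rightarrow>\<^sub>L 'h\<close> consists of the bounded \<^emph>\<open>real\<close>-linear maps; \<open>L(H)\<close> is the set
  of the complex-linear ones.\<close>

definition bounded_operators :: "('h::complex_hilbert_space \<Rightarrow>\<^sub>L 'h) set" where
  "bounded_operators = {A :: 'h \<Rightarrow>\<^sub>L 'h. \<forall>c x. A (c *\<^sub>C x) = c *\<^sub>C A x}"

definition op_scaleC ::
    "complex \<Rightarrow> ('h::complex_hilbert_space \<Rightarrow>\<^sub>L 'h) \<Rightarrow> ('h \<Rightarrow>\<^sub>L 'h)" where
  "op_scaleC c A = Blinfun (\<lambda>x. c *\<^sub>C x) o\<^sub>L A"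

lemma op_scaleC_apply: "op_scaleC c A x = c *\<^sub>C A x"
  by (simp add: op_scaleC_def bounded_linear_Blinfun_apply[OF bounded_linear_scaleC])

text \<open>The adjoint is meaningful only on \<^const>\<open>bounded_operators\<close>, where it exists by the
  Riesz representation theorem.\<close>

definition op_adjoint :: "('h::complex_hilbert_space \<Rightarrow>\<^sub>L 'h) \<Rightarrow> ('h \<Rightarrow>\<^sub>L 'h)" where
  "op_adjoint A = (THE B :: 'h \<Rightarrow>\<^sub>L 'h. \<forall>x y. cinner (A x) y = cinner x (B y))"

primrec op_power :: "('h::complex_hilbert_space \<Rightarrow>\<^sub>L 'h) \<Rightarrow> nat \<Rightarrow> ('h \<Rightarrow>\<^sub>L 'h)" where
  "op_power A 0 = id_blinfun"
| "op_power A (Suc n) = A o\<^sub>L op_power A n"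

definition initial_space :: "('h::complex_hilbert_space \<Rightarrow>\<^sub>L 'h) \<Rightarrow> 'h set" where
  "initial_space V = {x. \<forall>y. V y = 0 \<longrightarrow> cinner x y = 0}"

definition final_space :: "('h::complex_hilbert_space \<Rightarrow>\<^sub>L 'h) \<Rightarrow> 'h set" where
  "final_space V = range (blinfun_apply V)"

definition partial_isometry :: "('h::complex_hilbert_space \<Rightarrow>\<^sub>L 'h) \<Rightarrow> bool" where
  "partial_isometry V \<longleftrightarrow>
     V \<in> bounded_operators \<and> (\<forall>x \<in> initial_space V. norm (V x) = norm x)"

text \<open>The topology of \<open>'h \<Rightarrow>\<^sub>L 'h\<close>, hence \<^const>\<open>closed\<close>, is that of the operator norm.
  \<open>C\<^sup>*\<close>-subalgebras need not contain the identity.\<close>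

definition cstar_subalgebra :: "('h::complex_hilbert_space \<Rightarrow>\<^sub>L 'h) set \<Rightarrow> bool" where
  "cstar_subalgebra B \<longleftrightarrow>
     B \<subseteq> bounded_operators \<and> 0 \<in> B \<and>
     (\<forall>S\<in>B. \<forall>T\<in>B. S + T \<in> B) \<and>
     (\<forall>c. \<forall>S\<in>B. op_scaleC c S \<in> B) \<and>
     (\<forall>S\<in>B. \<forall>T\<in>B. S o\<^sub>L T \<in> B) \<and>
     (\<forall>S\<in>B. op_adjoint S \<in> B) \<and>
     closed B"

definition cstar_generated ::
    "('h::complex_hilbert_space \<Rightarrow>\<^sub>L 'h) set \<Rightarrow> ('h \<Rightarrow>\<^sub>L 'h) set" where
  "cstar_generated S = \<Inter>{B. cstar_subalgebra B \<and> S \<subseteq> B}"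


section \<open>The algebra of continuous functions on a space\<close>

text \<open>Functions on the space \<open>T\<close> are represented by total functions that are \<open>0\<close> outside
  \<open>topspace T\<close>, so that the algebra operations of \<open>C(T)\<close> are the plain pointwise ones.\<close>

definition Cfun :: "'a topology \<Rightarrow> ('a \<Rightarrow> complex) set" where
  "Cfun T = {a. continuous_map T euclidean a \<and> (\<forall>x. x \<notin> topspace T \<longrightarrow> a x = 0)}"

definition Cfun_on :: "'a set \<Rightarrow> 'a topology \<Rightarrow> ('a \<Rightarrow> complex) set" where
  "Cfun_on K T = {a \<in> Cfun T. \<forall>x. x \<notin> K \<longrightarrow> a x = 0}"

definition representation ::
    "'a topology \<Rightarrow> (('a \<Rightarrow> complex) \<Rightarrow> ('h::complex_hilbert_space \<Rightarrow>\<^sub>L 'h)) \<Rightarrow> bool" where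
  "representation T \<pi> \<longleftrightarrow>
     (\<forall>a \<in> Cfun T. \<pi> a \<in> bounded_operators) \<and>
     (\<forall>a \<in> Cfun T. \<forall>b \<in> Cfun T. \<pi> (\<lambda>x. a x + b x) = \<pi> a + \<pi> b) \<and>
     (\<forall>c. \<forall>a \<in> Cfun T. \<pi> (\<lambda>x. c * a x) = op_scaleC c (\<pi> a)) \<and>
     (\<forall>a \<in> Cfun T. \<forall>b \<in> Cfun T. \<pi> (\<lambda>x. a x * b x) = \<pi> a o\<^sub>L \<pi> b) \<and>
     (\<forall>a \<in> Cfun T. \<pi> (\<lambda>x. cnj (a x)) = op_adjoint (\<pi> a))"

definition faithful_representation ::
    "'a topology \<Rightarrow> (('a \<Rightarrow> complex) \<Rightarrow> ('h::complex_hilbert_space \<Rightarrow>\<^sub>L 'h)) \<Rightarrow> bool" where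
  "faithful_representation T \<pi> \<longleftrightarrow> representation T \<pi> \<and> inj_on \<pi> (Cfun T)"

definition star_isomorphism ::
    "('h::complex_hilbert_space \<Rightarrow>\<^sub>L 'h) set \<Rightarrow> 'b topology \<Rightarrow>
     (('h \<Rightarrow>\<^sub>L 'h) \<Rightarrow> 'b \<Rightarrow> complex) \<Rightarrow> bool" where
  "star_isomorphism B T \<Phi> \<longleftrightarrow>
     bij_betw \<Phi> B (Cfun T) \<and>
     (\<forall>R\<in>B. \<forall>S\<in>B. \<Phi> (R + S) = (\<lambda>x. \<Phi> R x + \<Phi> S x)) \<and>
     (\<forall>c. \<forall>R\<in>B. \<Phi> (op_scaleC c R) = (\<lambda>x. c * \<Phi> R x)) \<and>
     (\<forall>R\<in>B. \<forall>S\<in>B. \<Phi> (R o\<^sub>L S) = (\<lambda>x. \<Phi> R x * \<Phi> S x)) \<and>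
     (\<forall>R\<in>B. \<Phi> (op_adjoint R) = (\<lambda>x. cnj (\<Phi> R x)))"


section \<open>Partial dynamical systems and covariant representations\<close>

text \<open>A partial map \<open>\<alpha> : \<Delta>\<^sub>1 \<rightarrow> X\<close> is given by \<open>D = \<Delta>\<^sub>1\<close> and a total function \<open>\<alpha>\<close> whose values
  outside \<open>D\<close> are irrelevant; \<open>\<Delta>\<^bsub>-1\<^esub>\<close> is \<open>\<alpha> ` D\<close>.\<close>

definition partial_dynamical_system :: "'a topology \<Rightarrow> 'a set \<Rightarrow> ('a \<Rightarrow> 'a) \<Rightarrow> bool" where
  "partial_dynamical_system X D \<alpha> \<longleftrightarrow>
     compact_space X \<and> Hausdorff_space X \<and>
     openin X D \<and> closedin X D \<and>
     continuous_map (subtopology X D) X \<alpha> \<and> openin X (\<alpha> ` D)"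

primrec iter_domain :: "'a topology \<Rightarrow> 'a set \<Rightarrow> ('a \<Rightarrow> 'a) \<Rightarrow> nat \<Rightarrow> 'a set" where
  "iter_domain X D \<alpha> 0 = topspace X"
| "iter_domain X D \<alpha> (Suc n) = {x \<in> D. \<alpha> x \<in> iter_domain X D \<alpha> n}"

definition induced_endo ::
    "'a set \<Rightarrow> ('a \<Rightarrow> 'a) \<Rightarrow> ('a \<Rightarrow> complex) \<Rightarrow> ('a \<Rightarrow> complex)" where
  "induced_endo D \<alpha> a = (\<lambda>x. if x \<in> D then a (\<alpha> x) else 0)"

definition CovFaithRep ::
    "'a topology \<Rightarrow> 'a set \<Rightarrow> ('a \<Rightarrow> 'a) \<Rightarrow>
     ((('a \<Rightarrow> complex) \<Rightarrow> ('h::complex_hilbert_space \<Rightarrow>\<^sub>L 'h)) \<times> ('h \<Rightarrow>\<^sub>L 'h)) set" where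
  "CovFaithRep X D \<alpha> =
     {(\<pi>, U).
        faithful_representation X \<pi> \<and>
        partial_isometry U \<and>
        initial_space U = {\<pi> a h | a h. a \<in> Cfun_on (\<alpha> ` D) X} \<and>
        final_space U = {\<pi> a h | a h. a \<in> Cfun_on D X} \<and>
        (\<forall>a \<in> Cfun X. U o\<^sub>L \<pi> a o\<^sub>L op_adjoint U = \<pi> (induced_endo D \<alpha> a))}"


section \<open>The \<open>\<alpha>\<close>-extension\<close>

text \<open>\<open>X \<union> {0}\<close> is modelled on the option type: \<^term>\<open>None\<close> is the adjoined isolated point.\<close>

definition adjoin_isolated_point :: "'a topology \<Rightarrow> 'a option topology" where
  "adjoin_isolated_point X =
     topology (\<lambda>W. W \<subseteq> insert None (Some ` topspace X) \<and> openin X {x. Some x \<in> W})"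

lemma openin_adjoin_isolated_point:
  "openin (adjoin_isolated_point X) W \<longleftrightarrow>
     W \<subseteq> insert None (Some ` topspace X) \<and> openin X {x. Some x \<in> W}"
proof -
  have "istopology (\<lambda>W. W \<subseteq> insert None (Some ` topspace X) \<and> openin X {x. Some x \<in> W})"
    unfolding istopology_def
  proof (intro conjI allI impI)
    fix V W :: "'a option set"
    assume V: "V \<subseteq> insert None (Some ` topspace X) \<and> openin X {x. Some x \<in> V}"
      and W: "W \<subseteq> insert None (Some ` topspace X) \<and> openin X {x. Some x \<in> W}"
    show "V \<inter> W \<subseteq> insert None (Some ` topspace X)" using V by blast
    have "{x. Some x \<in> V \<inter> W} = {x. Some x \<in> V} \<inter> {x. Some x \<in> W}" by auto
    then show "openin X {x. Some x \<in> V \<inter> W}" using V W by auto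
  next
    fix \<W> :: "'a option set set"
    assume *: "\<forall>W\<in>\<W>. W \<subseteq> insert None (Some ` topspace X) \<and> openin X {x. Some x \<in> W}"
    show "\<Union>\<W> \<subseteq> insert None (Some ` topspace X)" using * by blast
    have "{x. Some x \<in> \<Union>\<W>} = (\<Union>W\<in>\<W>. {x. Some x \<in> W})" by auto
    then show "openin X {x. Some x \<in> \<Union>\<W>}" using * by auto
  qed
  then show ?thesis
    by (simp add: adjoin_isolated_point_def topology_inverse')
qed

definition ext_finite ::
    "'a topology \<Rightarrow> 'a set \<Rightarrow> ('a \<Rightarrow> 'a) \<Rightarrow> nat \<Rightarrow> (nat \<Rightarrow> 'a option) set" where
  "ext_finite X D \<alpha> N =
     {(\<lambda>n. if n \<le> N then Some (x n) else None) | x :: nat \<Rightarrow> 'a.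
        (\<forall>n\<le>N. x n \<in> iter_domain X D \<alpha> n) \<and> x N \<notin> \<alpha> ` D \<and>
        (\<forall>n. 1 \<le> n \<and> n \<le> N \<longrightarrow> \<alpha> (x n) = x (n - 1))}"

definition ext_infinite ::
    "'a topology \<Rightarrow> 'a set \<Rightarrow> ('a \<Rightarrow> 'a) \<Rightarrow> (nat \<Rightarrow> 'a option) set" where
  "ext_infinite X D \<alpha> =
     {(\<lambda>n. Some (x n)) | x :: nat \<Rightarrow> 'a.
        (\<forall>n. x n \<in> iter_domain X D \<alpha> n) \<and> (\<forall>n\<ge>1. \<alpha> (x n) = x (n - 1))}"

definition alpha_extension ::
    "'a topology \<Rightarrow> 'a set \<Rightarrow> ('a \<Rightarrow> 'a) \<Rightarrow> (nat \<Rightarrow> 'a option) topology" where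
  "alpha_extension X D \<alpha> =
     subtopology (product_topology (\<lambda>_. adjoin_isolated_point X) UNIV)
       ((\<Union>N. ext_finite X D \<alpha> N) \<union> ext_infinite X D \<alpha>)"

definition eval0 :: "('a \<Rightarrow> complex) \<Rightarrow> 'a option \<Rightarrow> complex" where
  "eval0 a p = (case p of None \<Rightarrow> 0 | Some x \<Rightarrow> a x)"

end

theory Submission
  imports Defs
begin

text \<open>Write \<open>T n a = U\<^sup>*\<^sup>n \<pi>(a) U\<^sup>n\<close>. Since \<open>U\<^sup>*U = \<pi>(i)\<close> for the indicator \<open>i\<close> of \<open>\<Delta>\<^bsub>-1\<^esub>\<close>, covariance
  gives \<open>U \<pi>(a) = \<pi>(\<delta>(a)) U\<close> and hence \<open>T n a T m b = T m (\<delta>\<^bsup>m-n\<^esup>(a) b)\<close> for \<open>n \<le> m\<close>; the functions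
  \<open>a(x\<^sub>n)\<close> on the extension multiply in the same way. Because \<open>T n (i a) = T (n+1) (\<delta>(a))\<close>, every finite
  sum can be rewritten so that its terms have disjoint supports on the extension. Such a sum vanishes,
  as an operator or as a function, only if all its coefficients do, and continuous functional calculus
  acts on it termwise. The correspondence is therefore well defined and injective, and it is isometric
  because the function algebra contains square roots. By Stone-Weierstrass these functions are dense
  in the continuous functions on the compact extension, so the correspondence extends to the
  closures.\<close>

section \<open>Hilbert space preliminaries\<close>

text \<open>\<pi> need not preserve the identity: \<pi>(1) is only a projection, and the unit has to
  be carried along as such. Functions vanish outside the space, and absent terms must stay absent
  under a termwise calculus, whence the restriction to h with h(0) = 0. A finite sum has many
  coefficient sequences, so no map is defined on sums; functions and operators are paired by a
  relation, and single-valuedness in both directions is reduced to comparison with zero. The norm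
  estimates use no spectral theory: if |f| \<le> r, then d = sqrt(r^2 - |f|^2) gives |d|^2 + |f|^2 =
  r^2, which the pairing carries to operators and which bounds the norm there; conversely, with r
  the operator norm, the positive part of |f|^2 - r^2 is forced to vanish. Stone-Weierstrass speaks
  of compact sets in a Hausdorff type, while the extension is an abstract topology, so points are
  replaced by their evaluations.\<close>

lemma scaleC_zero_left [simp]: "0 *\<^sub>C (x::'h::complex_hilbert_space) = 0"
  by (metis norm_eq_zero norm_scaleC mult_zero_left norm_zero)

lemma scaleC_minus_one: "(-1) *\<^sub>C (x::'h::complex_hilbert_space) = - x"
proof -
  have "(-1) *\<^sub>C x = complex_of_real (-1) *\<^sub>C x" by simp
  also have "\<dots> = (-1) *\<^sub>R x" by (simp only: scaleR_eq_scaleC)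
  finally show ?thesis by simp
qed

lemma cinner_add_right: "cinner (x::'h::complex_hilbert_space) (y + z) = cinner x y + cinner x z"
  by (metis cinner_add_left cinner_commute complex_cnj_add)

lemma cinner_scaleC_right: "cinner (x::'h::complex_hilbert_space) (c *\<^sub>C y) = cnj c * cinner x y"
  by (metis cinner_scaleC_left cinner_commute complex_cnj_mult)

lemma cinner_minus_left: "cinner (- x::'h::complex_hilbert_space) y = - cinner x y"
  using cinner_scaleC_left[of "-1" x y] by (simp add: scaleC_minus_one)

lemma cinner_minus_right: "cinner (x::'h::complex_hilbert_space) (- y) = - cinner x y"
  using cinner_scaleC_right[of x "-1" y] by (simp add: scaleC_minus_one)

lemma cinner_diff_left: "cinner (x - y::'h::complex_hilbert_space) z = cinner x z - cinner y z"
  using cinner_add_left[of x "- y" z] by (simp add: cinner_minus_left)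

lemma cinner_diff_right: "cinner (x::'h::complex_hilbert_space) (y - z) = cinner x y - cinner x z"
  using cinner_add_right[of x y "- z"] by (simp add: cinner_minus_right)

lemma cinner_zero_left [simp]: "cinner (0::'h::complex_hilbert_space) y = 0"
  using cinner_diff_left[of 0 0 y] by simp

lemma cinner_zero_right [simp]: "cinner (x::'h::complex_hilbert_space) 0 = 0"
  using cinner_diff_right[of x 0 0] by simp

lemma cinner_self: "cinner (x::'h::complex_hilbert_space) x = complex_of_real ((norm x)\<^sup>2)"
proof (rule complex_eqI)
  show "Re (cinner x x) = Re (complex_of_real ((norm x)\<^sup>2))"
    by (simp add: norm_eq_sqrt_cinner cinner_self_nonneg)
  show "Im (cinner x x) = Im (complex_of_real ((norm x)\<^sup>2))"
    using arg_cong[OF cinner_commute[of x x], of Im] by simp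
qed

lemma cinner_ext_left:
  assumes "\<And>z. cinner (x::'h::complex_hilbert_space) z = cinner y z" shows "x = y"
proof -
  have "cinner (x - y) (x - y) = 0" using assms by (simp add: cinner_diff_left)
  then show ?thesis using cinner_self_eq_0_iff[of "x - y"] by simp
qed

lemma cinner_ext_right:
  assumes "\<And>z. cinner z (x::'h::complex_hilbert_space) = cinner z y" shows "x = y"
  by (rule cinner_ext_left) (metis assms cinner_commute)

section \<open>Geometry of the norm and the Riesz representation theorem\<close>

lemma norm_add_square:
  "(norm (x + y::'h::complex_hilbert_space))\<^sup>2 = (norm x)\<^sup>2 + (norm y)\<^sup>2 + 2 * Re (cinner x y)"
proof -
  have "complex_of_real ((norm (x + y))\<^sup>2) = cinner (x + y) (x + y)" by (simp only: cinner_self)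
  also have "\<dots> = cinner x x + cinner y y + (cinner x y + cnj (cinner x y))"
    using cinner_commute[of y x] by (simp add: cinner_add_left cinner_add_right)
  also have "\<dots> = complex_of_real ((norm x)\<^sup>2 + (norm y)\<^sup>2 + 2 * Re (cinner x y))"
    unfolding cinner_self complex_add_cnj by (simp only: of_real_add)
  finally show ?thesis by (simp only: of_real_eq_iff)
qed

lemma parallelogram_law:
  "(norm (x + y::'h::complex_hilbert_space))\<^sup>2 + (norm (x - y))\<^sup>2 = 2 * (norm x)\<^sup>2 + 2 * (norm y)\<^sup>2"
  using norm_add_square[of x y] norm_add_square[of x "- y"] by (simp add: cinner_minus_right)

lemma Cauchy_Schwarz_cinner: "cmod (cinner (x::'h::complex_hilbert_space) y) \<le> norm x * norm y"
proof (cases "y = 0")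
  case False
  define c where "c = cinner x y"
  define n where "n = (norm y)\<^sup>2"
  have n: "n > 0" using False by (simp add: n_def)
  \<comment> \<open>x - (c/n) y is x minus its projection onto the line of y; its squared norm is
    |x|^2 - |c|^2 / n.\<close>
  have "0 \<le> (norm (x + (- (c / n)) *\<^sub>C y))\<^sup>2" by simp
  also have "\<dots> = (norm x)\<^sup>2 + (cmod c / n)\<^sup>2 * n + 2 * Re (- (cnj c / n) * c)"
    unfolding norm_add_square norm_scaleC cinner_scaleC_right power_mult_distrib norm_minus_cancel
      norm_divide n_def[symmetric]
    using n by (simp add: c_def[symmetric] n_def[symmetric])
  also have "- (cnj c / n) * c = complex_of_real (- ((cmod c)\<^sup>2 / n))"
    using complex_norm_square[of c] by (simp add: mult.commute)
  also have "(norm x)\<^sup>2 + (cmod c / n)\<^sup>2 * n + 2 * Re (complex_of_real (- ((cmod c)\<^sup>2 / n)))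
      = (norm x)\<^sup>2 - (cmod c)\<^sup>2 / n"
    using n by (simp add: power2_eq_square field_simps)
  finally have "(cmod c)\<^sup>2 \<le> (norm x)\<^sup>2 * n" using n by (simp add: field_simps)
  then have "(cmod c)\<^sup>2 \<le> (norm x * norm y)\<^sup>2" by (simp add: n_def power_mult_distrib)
  then show ?thesis unfolding c_def by (rule power2_le_imp_le) simp
qed simp

text \<open>The hyperplane f = 1 has a point x0 of least norm, and minimality makes x0 orthogonal to
  the kernel of f. Since x - f(x) x0 lies in that kernel, y = x0 / |x0|^2 represents f.\<close>

lemma riesz_representation:
  fixes f :: "'h::complex_hilbert_space \<Rightarrow> complex"
  assumes f: "bounded_linear f" and fC: "\<And>c x. f (c *\<^sub>C x) = c * f x"
  obtains y where "\<And>x. f x = cinner x y"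
proof (cases "\<forall>x. f x = 0")
  case True
  then show ?thesis using that[of 0] by simp
next
  case False
  then obtain u where u: "f u \<noteq> 0" by blast
  define S where "S = {x. f x = 1}"
  define d where "d = Inf ((\<lambda>x. (norm x)\<^sup>2) ` S)"
  have bdd: "bdd_below ((\<lambda>x. (norm x)\<^sup>2) ` S)" by (rule bdd_belowI[of _ 0]) auto
  have dle: "d \<le> (norm x)\<^sup>2" if "f x = 1" for x
    unfolding d_def using that bdd by (intro cInf_lower) (auto simp: S_def)
  have "(1 / f u) *\<^sub>C u \<in> S" using u by (simp add: S_def fC)
  then have ne: "(\<lambda>x. (norm x)\<^sup>2) ` S \<noteq> {}" by blast
  have "\<exists>x. f x = 1 \<and> (norm x)\<^sup>2 < d + 1 / real (Suc n)" for n
  proof -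
    have "d < d + 1 / real (Suc n)" by simp
    then show ?thesis unfolding d_def cInf_less_iff[OF ne bdd] by (auto simp: S_def)
  qed
  then obtain xs where xs1: "\<And>n. f (xs n) = 1" and xs2: "\<And>n. (norm (xs n))\<^sup>2 < d + 1 / real (Suc n)"
    by metis
  have addf: "f (x + y) = f x + f y" and scf: "f (r *\<^sub>R x) = r *\<^sub>R f x" for x y r
    using f by (auto simp: bounded_linear.linear linear_add linear_cmul)
  \<comment> \<open>The midpoint of two points with f = 1 also satisfies f = 1, so its squared norm
    is at least d; the parallelogram law then makes the minimizing sequence Cauchy.\<close>
  have close: "(norm (xs m - xs n))\<^sup>2 \<le> 2 / real (Suc m) + 2 / real (Suc n)" for m n
  proof -
    have "f ((1/2) *\<^sub>R (xs m + xs n)) = 1" by (simp add: addf scf xs1 scaleR_conv_of_real)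
    then have "d \<le> (norm ((1/2) *\<^sub>R (xs m + xs n)))\<^sup>2" by (rule dle)
    then have "4 * d \<le> (norm (xs m + xs n))\<^sup>2" by (simp add: power_mult_distrib power_divide)
    then show ?thesis
      using parallelogram_law[of "xs m" "xs n"] xs2[of m] xs2[of n] by simp
  qed
  have "Cauchy xs"
  proof (rule metric_CauchyI)
    fix e :: real assume e: "e > 0"
    obtain M where M: "1 / real (Suc M) < e\<^sup>2 / 4"
      using nat_approx_posE[of "e\<^sup>2/4"] e by auto
    have "dist (xs m) (xs n) < e" if "m \<ge> M" "n \<ge> M" for m n
    proof -
      have "1 / real (Suc m) \<le> 1 / real (Suc M)" "1 / real (Suc n) \<le> 1 / real (Suc M)"
        using that by (auto simp: frac_le)
      then have "(norm (xs m - xs n))\<^sup>2 < e\<^sup>2" using close[of m n] M by simp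
      then show ?thesis using e unfolding dist_norm by (simp add: power_less_imp_less_base)
    qed
    then show "\<exists>M. \<forall>m\<ge>M. \<forall>n\<ge>M. dist (xs m) (xs n) < e" by blast
  qed
  then obtain x0 where x0: "xs \<longlonglongrightarrow> x0" using Cauchy_convergent_iff convergent_def by blast
  have "(\<lambda>n. f (xs n)) \<longlonglongrightarrow> f x0" by (rule bounded_linear.tendsto[OF f x0])
  then have fx0: "f x0 = 1" using xs1 by (simp add: LIMSEQ_const_iff)
  have "(\<lambda>n. (norm (xs n))\<^sup>2) \<longlonglongrightarrow> (norm x0)\<^sup>2" using x0 by (intro tendsto_intros)
  moreover have "(\<lambda>n. d + 1 / real (Suc n)) \<longlonglongrightarrow> d + 0"
    by (intro tendsto_intros) (use LIMSEQ_inverse_real_of_nat in \<open>simp add: inverse_eq_divide\<close>)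
  ultimately have nx0: "(norm x0)\<^sup>2 \<le> d"
    by (intro LIMSEQ_le[of _ "(norm x0)\<^sup>2" _ d]) (use xs2 less_imp_le in auto)
  have orth: "cinner z x0 = 0" if z: "f z = 0" for z
  proof (cases "z = 0")
    case False
    define c where "c = cinner x0 z"
    define n where "n = (norm z)\<^sup>2"
    have n: "n > 0" using False by (simp add: n_def)
    \<comment> \<open>Moving along the kernel stays in f = 1. The multiple c/n makes the norm
      smallest, and minimality of x0 leaves |c|^2 / n \<le> 0.\<close>
    have "f (x0 + (- (c / n)) *\<^sub>C z) = 1" by (simp add: addf fC z fx0)
    then have "(norm x0)\<^sup>2 \<le> (norm (x0 + (- (c / n)) *\<^sub>C z))\<^sup>2" using dle nx0 order_trans by blast
    also have "\<dots> = (norm x0)\<^sup>2 + (cmod c / n)\<^sup>2 * n + 2 * Re (- (cnj c / n) * c)"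
      unfolding norm_add_square norm_scaleC cinner_scaleC_right power_mult_distrib norm_minus_cancel
      norm_divide n_def[symmetric]
      using n by (simp add: c_def[symmetric] n_def[symmetric])
    also have "- (cnj c / n) * c = complex_of_real (- ((cmod c)\<^sup>2 / n))"
      using complex_norm_square[of c] by (simp add: mult.commute)
    also have "(norm x0)\<^sup>2 + (cmod c / n)\<^sup>2 * n + 2 * Re (complex_of_real (- ((cmod c)\<^sup>2 / n)))
        = (norm x0)\<^sup>2 - (cmod c)\<^sup>2 / n"
      using n by (simp add: power2_eq_square field_simps)
    finally have "(cmod c)\<^sup>2 / n \<le> 0" by simp
    then have "c = 0" using n by (simp add: divide_le_0_iff)
    then show ?thesis using cinner_commute[of z x0] by (simp add: c_def)
  qed simp
  have x0n: "x0 \<noteq> 0" using fx0 fC[of 0 x0] by auto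
  define k where "k = complex_of_real ((norm x0)\<^sup>2)"
  have kn: "k \<noteq> 0" using x0n by (simp add: k_def)
  show ?thesis
  proof (rule that[of "(1 / k) *\<^sub>C x0"])
    fix x
    have "f (x + (- f x) *\<^sub>C x0) = 0" by (simp only: addf fC fx0) simp
    then have "cinner (x + (- f x) *\<^sub>C x0) x0 = 0" by (rule orth)
    then have "cinner x x0 = f x * k"
      by (simp add: cinner_add_left cinner_scaleC_left cinner_self k_def)
    then show "f x = cinner x ((1 / k) *\<^sub>C x0)"
      using kn by (simp add: cinner_scaleC_right k_def)
  qed
qed

section \<open>Existence and calculus of adjoints\<close>

lemma bounded_linear_cinner_left: "bounded_linear (\<lambda>x. cinner x (y::'h::complex_hilbert_space))"
proof (rule bounded_linear_intro[where K = "norm y"])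
  fix r :: real and x :: 'h
  show "cinner (r *\<^sub>R x) y = r *\<^sub>R cinner x y"
    by (simp add: scaleR_eq_scaleC cinner_scaleC_left scaleR_conv_of_real)
qed (auto simp: cinner_add_left Cauchy_Schwarz_cinner)

text \<open>For fixed y the functional x -> <A x, y> is represented by a vector B y. Uniqueness of
  that vector makes B linear, and |B y|^2 = <A (B y), y> bounds it by the norm of A.\<close>

lemma ex_adjoint:
  assumes A: "A \<in> bounded_operators"
  shows "\<exists>B \<in> bounded_operators. \<forall>x y. cinner (blinfun_apply A x) y = cinner x (blinfun_apply B y)"
proof -
  have "\<exists>z. \<forall>x. cinner (A x) y = cinner x z" for y
  proof -
    have bl: "bounded_linear (\<lambda>x. cinner (A x) y)"
      by (rule bounded_linear_compose[OF bounded_linear_cinner_left blinfun.bounded_linear_right])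
    have "cinner (A (c *\<^sub>C x)) y = c * cinner (A x) y" for c x
      using A by (simp add: bounded_operators_def cinner_scaleC_left)
    from riesz_representation[OF bl this] show ?thesis by metis
  qed
  then obtain B where B: "\<And>x y. cinner (A x) y = cinner x (B y)" by metis
  have addB: "B (x + y) = B x + B y" for x y
    by (rule cinner_ext_right) (simp add: B[symmetric] cinner_add_right)
  have scB: "B (c *\<^sub>C x) = c *\<^sub>C B x" for c x
    by (rule cinner_ext_right) (simp add: B[symmetric] cinner_scaleC_right)
  have bl: "bounded_linear B"
  proof (rule bounded_linear_intro[where K = "norm A"])
    show "B (x + y) = B x + B y" for x y by (rule addB)
    show "B (r *\<^sub>R x) = r *\<^sub>R B x" for r x by (simp add: scaleR_eq_scaleC scB)
    fix y
    have "(norm (B y))\<^sup>2 = cmod (cinner (A (B y)) y)"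
      by (simp add: B cinner_self norm_power)
    also have "\<dots> \<le> norm (A (B y)) * norm y" by (rule Cauchy_Schwarz_cinner)
    also have "\<dots> \<le> norm A * norm (B y) * norm y" by (intro mult_right_mono norm_blinfun) simp
    finally have "norm (B y) * norm (B y) \<le> norm (B y) * (norm y * norm A)"
      by (simp add: power2_eq_square ac_simps)
    then show "norm (B y) \<le> norm y * norm A"
      by (cases "norm (B y) = 0") (auto simp: mult_le_cancel_left)
  qed
  show ?thesis
  proof (rule bexI[of _ "Blinfun B"])
    show "\<forall>x y. cinner (A x) y = cinner x (Blinfun B y)"
      by (simp add: bounded_linear_Blinfun_apply[OF bl] B)
    show "Blinfun B \<in> bounded_operators"
      by (simp add: bounded_operators_def bounded_linear_Blinfun_apply[OF bl] scB)
  qed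
qed

text \<open>\<open>op_adjoint\<close> is a definite description; since the inner product separates
  vectors, exhibiting any operator with the adjoint identity identifies it.\<close>

lemma op_adjoint_eqI:
  assumes "\<And>x y. cinner (blinfun_apply A x) y = cinner x (blinfun_apply B y)"
  shows "op_adjoint A = B"
  unfolding op_adjoint_def
proof (rule the_equality)
  show "\<forall>x y. cinner (A x) y = cinner x (B y)" using assms by blast
  fix C assume "\<forall>x y. cinner (A x) y = cinner x (blinfun_apply C y)"
  then show "C = B" using assms by (intro blinfun_eqI cinner_ext_right) metis
qed

lemma
  assumes "A \<in> bounded_operators"
  shows cinner_adjoint_right: "cinner x (op_adjoint A y) = cinner (A x) y"
    and op_adjoint_bounded: "op_adjoint A \<in> bounded_operators"
  using ex_adjoint[OF assms] op_adjoint_eqI by metis+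

lemma cinner_adjoint_left:
  assumes "A \<in> bounded_operators"
  shows "cinner (op_adjoint A y) x = cinner y (A x)"
  by (metis assms cinner_adjoint_right cinner_commute)

lemma op_adjoint_adjoint: "A \<in> bounded_operators \<Longrightarrow> op_adjoint (op_adjoint A) = A"
  by (rule op_adjoint_eqI) (simp add: cinner_adjoint_left)

lemma op_adjoint_compose:
  assumes "A \<in> bounded_operators" "B \<in> bounded_operators"
  shows "op_adjoint (A o\<^sub>L B) = op_adjoint B o\<^sub>L op_adjoint A"
  by (rule op_adjoint_eqI) (simp add: assms cinner_adjoint_right)

lemma op_adjoint_add:
  assumes "A \<in> bounded_operators" "B \<in> bounded_operators"
  shows "op_adjoint (A + B) = op_adjoint A + op_adjoint B"
  by (rule op_adjoint_eqI)
    (simp add: assms cinner_adjoint_right cinner_add_left cinner_add_right blinfun.add_left)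

lemma op_adjoint_diff:
  assumes "A \<in> bounded_operators" "B \<in> bounded_operators"
  shows "op_adjoint (A - B) = op_adjoint A - op_adjoint B"
  by (rule op_adjoint_eqI)
    (simp add: assms cinner_adjoint_right cinner_diff_left cinner_diff_right blinfun.diff_left)

lemma norm_op_adjoint_le:
  assumes A: "A \<in> bounded_operators"
  shows "norm (op_adjoint A) \<le> norm A"
proof (rule norm_blinfun_bound)
  fix y
  let ?B = "blinfun_apply (op_adjoint A)"
  have "(norm (?B y))\<^sup>2 = cmod (cinner (A (?B y)) y)"
    unfolding cinner_adjoint_right[OF A, symmetric] by (simp add: cinner_self norm_power)
  also have "\<dots> \<le> norm (A (?B y)) * norm y" by (rule Cauchy_Schwarz_cinner)
  also have "\<dots> \<le> norm A * norm (?B y) * norm y" by (intro mult_right_mono norm_blinfun) simp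
  finally have "norm (?B y) * norm (?B y) \<le> norm (?B y) * (norm A * norm y)"
    by (simp add: power2_eq_square ac_simps)
  then show "norm (?B y) \<le> norm A * norm y"
    by (cases "norm (?B y) = 0") (auto simp: mult_le_cancel_left)
qed simp

text \<open>Turns identities among operators A^*A into identities of squared norms, which is how
  positivity enters without an order on operators.\<close>

lemma norm_square_eq_adjoint:
  assumes "A \<in> bounded_operators"
  shows "complex_of_real ((norm (A x))\<^sup>2) = cinner ((op_adjoint A o\<^sub>L A) x) x"
  by (simp add: assms cinner_adjoint_left cinner_self)

text \<open>Polarization: the vectors x + y and x + i y show that the form of A - B is both
  antisymmetric and symmetric.\<close>

lemma cinner_quadratic_eqI:
  fixes A B :: "'h::complex_hilbert_space \<Rightarrow>\<^sub>L 'h"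
  assumes A: "A \<in> bounded_operators" and B: "B \<in> bounded_operators"
    and AB: "\<And>x. cinner (blinfun_apply A x) x = cinner (blinfun_apply B x) x"
  shows "A = B"
proof (rule blinfun_eqI, rule cinner_ext_left)
  fix x y
  let ?g = "\<lambda>x y. cinner (A x) y - cinner (B x) y"
  have g: "?g x x = 0" for x using AB by simp
  have sA: "A (c *\<^sub>C x) = c *\<^sub>C A x" "B (c *\<^sub>C x) = c *\<^sub>C B x" for c x
    using A B by (auto simp: bounded_operators_def)
  have 1: "?g x y + ?g y x = 0"
    using g[of "x + y"] g[of x] g[of y]
    by (simp add: blinfun.add_right cinner_add_left cinner_add_right algebra_simps)
  have 2: "\<i> * ?g y x - \<i> * ?g x y = 0"
    using g[of "x + \<i> *\<^sub>C y"] g[of x] g[of y]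
    by (simp add: blinfun.add_right cinner_add_left cinner_add_right sA cinner_scaleC_left
        cinner_scaleC_right algebra_simps)
  from 2 have "\<i> * (?g y x - ?g x y) = 0" by (simp only: right_diff_distrib)
  then have "?g x y = ?g y x" by simp
  with 1 show "cinner (A x) y = cinner (B x) y" by simp
qed

section \<open>Algebraic operations on L(H)\<close>

lemma
  fixes A B :: "'h::complex_hilbert_space \<Rightarrow>\<^sub>L 'h"
  shows id_bounded_operators: "(id_blinfun :: 'h \<Rightarrow>\<^sub>L 'h) \<in> bounded_operators"
    and add_bounded_operators: "A \<in> bounded_operators \<Longrightarrow> B \<in> bounded_operators \<Longrightarrow> A + B \<in> bounded_operators"
    and diff_bounded_operators: "A \<in> bounded_operators \<Longrightarrow> B \<in> bounded_operators \<Longrightarrow> A - B \<in> bounded_operators"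
    and compose_bounded_operators: "A \<in> bounded_operators \<Longrightarrow> B \<in> bounded_operators \<Longrightarrow> A o\<^sub>L B \<in> bounded_operators"
proof -
  have m: "c *\<^sub>C (x - y) = c *\<^sub>C x - c *\<^sub>C (y::'h)" for c x y
    by (metis add_diff_cancel_right' diff_add_cancel scaleC_add_right)
  show "(id_blinfun :: 'h \<Rightarrow>\<^sub>L 'h) \<in> bounded_operators" by (simp add: bounded_operators_def)
  show "A \<in> bounded_operators \<Longrightarrow> B \<in> bounded_operators \<Longrightarrow> A + B \<in> bounded_operators"
    by (simp add: bounded_operators_def blinfun.add_left scaleC_add_right)
  show "A \<in> bounded_operators \<Longrightarrow> B \<in> bounded_operators \<Longrightarrow> A - B \<in> bounded_operators"
    by (simp add: bounded_operators_def blinfun.diff_left m)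
  show "A \<in> bounded_operators \<Longrightarrow> B \<in> bounded_operators \<Longrightarrow> A o\<^sub>L B \<in> bounded_operators"
    by (simp add: bounded_operators_def)
qed

lemma op_power_bounded_operators: "A \<in> bounded_operators \<Longrightarrow> op_power A n \<in> bounded_operators"
  by (induction n) (simp_all add: id_bounded_operators compose_bounded_operators)

lemma op_power_commute: "op_power A n o\<^sub>L A = A o\<^sub>L op_power A n"
proof (induction n)
  case (Suc n)
  have "op_power A (Suc n) o\<^sub>L A = A o\<^sub>L (op_power A n o\<^sub>L A)" by (rule blinfun_eqI) simp
  then show ?case using Suc by simp
qed (simp add: blinfun_eqI)

lemma op_adjoint_op_power:
  assumes "A \<in> bounded_operators"
  shows "op_adjoint (op_power A n) = op_power (op_adjoint A) n"
proof (induction n)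
  case 0
  show ?case by (rule op_adjoint_eqI) simp
next
  case (Suc n)
  then show ?case
    using op_adjoint_compose[OF assms op_power_bounded_operators[OF assms, of n]]
    by (simp add: op_power_commute)
qed

lemma op_scaleC_of_real: "op_scaleC (complex_of_real r) A = r *\<^sub>R A"
  by (rule blinfun_eqI) (simp add: op_scaleC_apply blinfun.scaleR_left scaleR_eq_scaleC)

lemma op_scaleC_add: "op_scaleC c (A + B) = op_scaleC c A + op_scaleC c B"
  by (rule blinfun_eqI) (simp add: op_scaleC_apply blinfun.add_left scaleC_add_right)

lemma op_scaleC_compose_left: "op_scaleC c A o\<^sub>L B = op_scaleC c (A o\<^sub>L B)"
  by (rule blinfun_eqI) (simp add: op_scaleC_apply)

lemma op_scaleC_compose_right:
  "A \<in> bounded_operators \<Longrightarrow> A o\<^sub>L op_scaleC c B = op_scaleC c (A o\<^sub>L B)"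
  by (rule blinfun_eqI) (simp add: op_scaleC_apply bounded_operators_def)

lemma blinfun_compose_assoc: "(A o\<^sub>L B) o\<^sub>L C = A o\<^sub>L (B o\<^sub>L C)"
  by (rule blinfun_eqI) simp

lemmas blinfun_compose_distribs =
  bounded_bilinear.add_left[OF bounded_bilinear_blinfun_compose]
  bounded_bilinear.add_right[OF bounded_bilinear_blinfun_compose]
  bounded_bilinear.diff_left[OF bounded_bilinear_blinfun_compose]
  bounded_bilinear.diff_right[OF bounded_bilinear_blinfun_compose]
  bounded_bilinear.zero_left[OF bounded_bilinear_blinfun_compose]
  bounded_bilinear.zero_right[OF bounded_bilinear_blinfun_compose]

text \<open>The ambient type also contains merely real-linear maps, so complex linearity has to
  survive norm limits; it is an intersection of closed conditions, one for each scalar and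
  vector.\<close>

lemma closed_bounded_operators: "closed (bounded_operators :: ('h::complex_hilbert_space \<Rightarrow>\<^sub>L 'h) set)"
proof -
  have *: "(bounded_operators :: ('h \<Rightarrow>\<^sub>L 'h) set) = (\<Inter>c x. {A :: 'h \<Rightarrow>\<^sub>L 'h. A (c *\<^sub>C x) = c *\<^sub>C A x})"
    by (auto simp: bounded_operators_def)
  have "closed {A :: 'h \<Rightarrow>\<^sub>L 'h. A (c *\<^sub>C x) = c *\<^sub>C A x}" for c x
    by (intro closed_Collect_eq continuous_intros
        bounded_linear.continuous_on[OF bounded_linear_scaleC])
  then have "closed (\<Inter>c x. {A :: 'h \<Rightarrow>\<^sub>L 'h. A (c *\<^sub>C x) = c *\<^sub>C A x})"
    by (intro closed_INT ballI)
  then show ?thesis unfolding * .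
qed

section \<open>Dense isometric star-algebras of functions\<close>

lemma open_coordinate_vimage:
  "open U \<Longrightarrow> open ((\<lambda>h :: 'a \<Rightarrow> 'b::topological_space. h i) -` U)"
  using open_vimage[of U "\<lambda>h. h i"] continuous_on_product_coordinates[of i] by blast

text \<open>The separation classes are nested, hence three instances; the goal is
  \<open>t2_space\<close>, because Stone-Weierstrass will be applied to a compact set in a function
  type.\<close>

instance "fun" :: (type, t0_space) t0_space
proof
  fix f g :: "'a \<Rightarrow> 'b"
  assume "f \<noteq> g"
  then obtain i where "f i \<noteq> g i" by blast
  then obtain U where U: "open U" "\<not> (f i \<in> U \<longleftrightarrow> g i \<in> U)"
    using separation_t0 by blast
  then show "\<exists>U. open U \<and> \<not> (f \<in> U \<longleftrightarrow> g \<in> U)"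
    by (intro exI[of _ "(\<lambda>h. h i) -` U"]) (simp add: open_coordinate_vimage)
qed

instance "fun" :: (type, t1_space) t1_space
proof
  fix f g :: "'a \<Rightarrow> 'b"
  assume "f \<noteq> g"
  then obtain i where "f i \<noteq> g i" by blast
  then obtain U where U: "open U" "f i \<in> U" "g i \<notin> U"
    using t1_space by blast
  then show "\<exists>U. open U \<and> f \<in> U \<and> g \<notin> U"
    by (intro exI[of _ "(\<lambda>h. h i) -` U"]) (simp add: open_coordinate_vimage)
qed

instance "fun" :: (type, t2_space) t2_space
proof
  fix f g :: "'a \<Rightarrow> 'b"
  assume "f \<noteq> g"
  then obtain i where "f i \<noteq> g i" by blast
  then obtain U V where UV: "open U" "open V" "f i \<in> U" "g i \<in> V" "U \<inter> V = {}"
    using hausdorff by metis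
  then have "(\<lambda>h. h i) -` U \<inter> (\<lambda>h. h i) -` V = {}" by blast
  with UV show "\<exists>U V. open U \<and> open V \<and> f \<in> U \<and> g \<in> V \<and> U \<inter> V = {}"
    by (intro exI[of _ "(\<lambda>h. h i) -` U"] exI[of _ "(\<lambda>h. h i) -` V"])
      (simp add: open_coordinate_vimage)
qed

section \<open>The algebra of continuous functions\<close>

lemma Cfun_cont: "f \<in> Cfun T \<Longrightarrow> continuous_map T euclidean f"
  and Cfun_outside: "f \<in> Cfun T \<Longrightarrow> x \<notin> topspace T \<Longrightarrow> f x = 0"
  by (auto simp: Cfun_def)

text \<open>The condition \<open>h 0 = 0\<close> keeps the composite zero outside
  \<open>topspace T\<close>, as membership in \<open>Cfun\<close> demands.\<close>

lemma Cfun_comp: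
  assumes "f \<in> Cfun T" "continuous_on UNIV h" "h 0 = 0"
  shows "(\<lambda>x. h (f x)) \<in> Cfun T"
  using assms continuous_map_compose[of T euclidean f euclidean h]
  by (auto simp: Cfun_def o_def continuous_map_iff_continuous2)

lemma Cfun_add: "f \<in> Cfun T \<Longrightarrow> g \<in> Cfun T \<Longrightarrow> (\<lambda>x. f x + g x) \<in> Cfun T"
  and Cfun_mult: "f \<in> Cfun T \<Longrightarrow> g \<in> Cfun T \<Longrightarrow> (\<lambda>x. f x * g x) \<in> Cfun T"
  and Cfun_zero: "(\<lambda>x. 0) \<in> Cfun T"
  by (auto simp: Cfun_def continuous_map_atin tendsto_add tendsto_mult)

lemma Cfun_scale: "f \<in> Cfun T \<Longrightarrow> (\<lambda>x. c * f x) \<in> Cfun T"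
  by (rule Cfun_comp[where h = "\<lambda>z. c * z"]) (auto intro!: continuous_intros)

lemma Cfun_cnj: "f \<in> Cfun T \<Longrightarrow> (\<lambda>x. cnj (f x)) \<in> Cfun T"
  by (rule Cfun_comp[where h = cnj]) (auto intro!: continuous_intros)

text \<open>\<open>gr\<close> is the graph of a star-isomorphism between an algebra of continuous functions on \<open>T\<close>
  and an algebra of operators; working with the graph avoids choosing representatives.\<close>

locale star_relation =
  fixes T :: "'b topology"
    and gr :: "('b \<Rightarrow> complex) \<Rightarrow> ('h::complex_hilbert_space \<Rightarrow>\<^sub>L 'h) \<Rightarrow> bool"
  assumes gr_Cfun: "gr f R \<Longrightarrow> f \<in> Cfun T"
    and gr_bounded: "gr f R \<Longrightarrow> R \<in> bounded_operators"
    and gr_add: "gr f R \<Longrightarrow> gr g S \<Longrightarrow> gr (\<lambda>x. f x + g x) (R + S)"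
    and gr_scale: "gr f R \<Longrightarrow> gr (\<lambda>x. c * f x) (op_scaleC c R)"
    and gr_mult: "gr f R \<Longrightarrow> gr g S \<Longrightarrow> gr (\<lambda>x. f x * g x) (R o\<^sub>L S)"
    and gr_adjoint: "gr f R \<Longrightarrow> gr (\<lambda>x. cnj (f x)) (op_adjoint R)"
    and gr_one: "\<exists>P. gr (\<lambda>x. if x \<in> topspace T then 1 else 0) P"
    and gr_comp: "gr f R \<Longrightarrow> continuous_on UNIV h \<Longrightarrow> h 0 = 0 \<Longrightarrow> \<exists>S. gr (\<lambda>x. h (f x)) S"
    and gr_eq_0: "gr f R \<Longrightarrow> (\<forall>x. f x = 0) \<longleftrightarrow> R = 0"
    and compact_T: "compact_space T"
    and separates: "p \<in> topspace T \<Longrightarrow> q \<in> topspace T \<Longrightarrow> p \<noteq> q \<Longrightarrow> \<exists>f R. gr f R \<and> f p \<noteq> f q"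
begin

section \<open>The correspondence is single-valued and isometric\<close>

lemma gr_diff: "gr f R \<Longrightarrow> gr g S \<Longrightarrow> gr (\<lambda>x. f x - g x) (R - S)"
  using gr_add[OF _ gr_scale[of g S "-1"], of f R] op_scaleC_of_real[of "-1" S] by simp

text \<open>Two partners of f differ by a partner of the zero function. This carries every pointwise
  identity of functions over to operators.\<close>

lemma gr_unique: "gr f R \<Longrightarrow> gr f S \<Longrightarrow> R = S"
  using gr_diff[of f R f S] gr_eq_0 by fastforce

lemma gr_zero: "gr (\<lambda>x. 0) 0"
proof -
  obtain P where "gr (\<lambda>x. if x \<in> topspace T then 1 else 0) P" using gr_one by blast
  from gr_diff[OF this this] show ?thesis by simp
qed

text \<open>With d = sqrt(r^2 - |f|^2), the identity |d|^2 + |f|^2 = r^2 passes to the partners D, R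
  and the partner P of the unit: D^*D + R^*R = r^2 P. Dropping the first square gives |R x|^2 \<le>
  r^2 |P x|^2 \<le> r^2 |x|^2.\<close>

lemma norm_le_if_bounded:
  assumes f: "gr f R" and r: "0 \<le> r" and fr: "\<And>x. cmod (f x) \<le> r"
  shows "norm R \<le> r"
proof -
  let ?one = "\<lambda>x. if x \<in> topspace T then 1 else (0::complex)"
  obtain P where P: "gr ?one P" using gr_one by blast
  have cnj1: "(\<lambda>x. cnj (?one x)) = ?one" and sq1: "(\<lambda>x. ?one x * ?one x) = ?one" by auto
  have "gr ?one (op_adjoint P)" "gr ?one (P o\<^sub>L P)"
    using gr_adjoint[OF P] gr_mult[OF P P] unfolding cnj1 sq1 .
  then have PP: "op_adjoint P = P" "P o\<^sub>L P = P" using P gr_unique by blast+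
  have bP: "P \<in> bounded_operators" using P by (rule gr_bounded)
  \<comment> \<open>P is self-adjoint and idempotent, hence a projection and a contraction, though
    perhaps not the identity.\<close>
  have nP: "(norm (P x))\<^sup>2 \<le> (norm x)\<^sup>2" for x
  proof -
    have "complex_of_real ((norm (P x))\<^sup>2) = cinner (P x) x"
      using norm_square_eq_adjoint[OF bP, of x] by (simp add: PP)
    then have "(norm (P x))\<^sup>2 = cmod (cinner (P x) x)"
      by (metis norm_of_real abs_of_nonneg zero_le_power2)
    also have "\<dots> \<le> norm (P x) * norm x" by (rule Cauchy_Schwarz_cinner)
    finally have "norm (P x) \<le> norm x"
      by (cases "norm (P x) = 0") (auto simp: power2_eq_square mult_le_cancel_left)
    then show ?thesis by (simp add: power_mono)
  qed
  \<comment> \<open>Subtracting r makes h(0) = 0, as \<open>gr_comp\<close> requires;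
    \<open>D\<close> puts r P back. On the values of f the \<open>max\<close> does nothing, since
    |f| \<le> r.\<close>
  define h where "h = (\<lambda>z. complex_of_real (sqrt (max 0 (r\<^sup>2 - (cmod z)\<^sup>2)) - r))"
  have "continuous_on UNIV h" "h 0 = 0"
    using r by (auto simp: h_def intro!: continuous_intros)
  then obtain S where S: "gr (\<lambda>x. h (f x)) S" using gr_comp[OF f] by blast
  define D where "D = S + op_scaleC (complex_of_real r) P"
  define d where "d = (\<lambda>x. h (f x) + complex_of_real r * ?one x)"
  have D: "gr d D" unfolding d_def D_def by (rule gr_add[OF S gr_scale[OF P]])
  have "cnj (d x) * d x + cnj (f x) * f x = complex_of_real (r\<^sup>2) * ?one x" for x
  proof (cases "x \<in> topspace T")
    case True
    have "(cmod (f x))\<^sup>2 \<le> r\<^sup>2" using fr[of x] by (simp add: power_mono)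
    then have "d x = complex_of_real (sqrt (r\<^sup>2 - (cmod (f x))\<^sup>2))" using True by (simp add: d_def h_def)
    then have "cnj (d x) * d x = complex_of_real (r\<^sup>2 - (cmod (f x))\<^sup>2)"
      using \<open>(cmod (f x))\<^sup>2 \<le> r\<^sup>2\<close> by (simp flip: of_real_mult)
    moreover have "cnj (f x) * f x = complex_of_real ((cmod (f x))\<^sup>2)"
      by (simp only: complex_norm_square mult.commute)
    ultimately show ?thesis using True by simp
  next
    case False
    then have "f x = 0" using gr_Cfun[OF f] by (simp add: Cfun_outside)
    then show ?thesis using False \<open>h 0 = 0\<close> by (simp add: d_def)
  qed
  then have eqf: "(\<lambda>x. cnj (d x) * d x + cnj (f x) * f x) = (\<lambda>x. complex_of_real (r\<^sup>2) * ?one x)" by blast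
  have "gr (\<lambda>x. cnj (d x) * d x + cnj (f x) * f x) ((op_adjoint D o\<^sub>L D) + (op_adjoint R o\<^sub>L R))"
    by (rule gr_add[OF gr_mult[OF gr_adjoint[OF D] D] gr_mult[OF gr_adjoint[OF f] f]])
  then have eq: "(op_adjoint D o\<^sub>L D) + (op_adjoint R o\<^sub>L R) = op_scaleC (complex_of_real (r\<^sup>2)) P"
    unfolding eqf by (rule gr_unique[OF _ gr_scale[OF P]])
  show ?thesis
  proof (rule norm_blinfun_bound[OF r])
    fix x
    have "complex_of_real ((norm (D x))\<^sup>2 + (norm (R x))\<^sup>2)
        = cinner (((op_adjoint D o\<^sub>L D) + (op_adjoint R o\<^sub>L R)) x) x"
      unfolding of_real_add norm_square_eq_adjoint[OF gr_bounded[OF D]] norm_square_eq_adjoint[OF gr_bounded[OF f]]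
      by (simp add: blinfun.add_left cinner_add_left)
    also have "\<dots> = complex_of_real (r\<^sup>2) * cinner ((op_adjoint P o\<^sub>L P) x) x"
      unfolding eq by (simp add: PP op_scaleC_apply cinner_scaleC_left del: blinfun_apply_blinfun_compose)
    also have "\<dots> = complex_of_real (r\<^sup>2 * (norm (P x))\<^sup>2)"
      unfolding of_real_mult norm_square_eq_adjoint[OF bP] ..
    finally have "(norm (D x))\<^sup>2 + (norm (R x))\<^sup>2 = r\<^sup>2 * (norm (P x))\<^sup>2" by (simp only: of_real_eq_iff)
    moreover have "r\<^sup>2 * (norm (P x))\<^sup>2 \<le> r\<^sup>2 * (norm x)\<^sup>2" using nP by (intro mult_left_mono) auto
    moreover have "0 \<le> (norm (D x))\<^sup>2" by simp
    ultimately have "(norm (R x))\<^sup>2 \<le> (r * norm x)\<^sup>2" unfolding power_mult_distrib by linarith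
    then show "norm (R x) \<le> r * norm x" by (rule power2_le_imp_le) (simp add: r)
  qed
qed

text \<open>Let r be the norm of R and t the positive part of |f|^2 - r^2. Then |f|^2 t = t^2 + r^2
  t pointwise, which for the partners G of sqrt(t) and K of t reads |R (G y)|^2 = |K y|^2 + r^2 |G
  y|^2. As |R (G y)| \<le> r |G y|, K vanishes, hence so does t.\<close>

lemma bounded_by_norm:
  assumes f: "gr f R"
  shows "cmod (f x) \<le> norm R"
proof -
  let ?r = "norm R"
  define g where "g = (\<lambda>z. complex_of_real (sqrt (max 0 ((cmod z)\<^sup>2 - ?r\<^sup>2))))"
  define k where "k = (\<lambda>z. complex_of_real (max 0 ((cmod z)\<^sup>2 - ?r\<^sup>2)))"
  have "continuous_on UNIV g" "g 0 = 0" "continuous_on UNIV k" "k 0 = 0"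
    by (auto simp: g_def k_def intro!: continuous_intros)
  then obtain G K where G: "gr (\<lambda>x. g (f x)) G" and K: "gr (\<lambda>x. k (f x)) K"
    using gr_comp[OF f] by metis
  have RG: "gr (\<lambda>x. f x * g (f x)) (R o\<^sub>L G)" using f G by (rule gr_mult)
  have "cnj (k z) * k z + complex_of_real (?r\<^sup>2) * (cnj (g z) * g z) = cnj (z * g z) * (z * g z)" for z
  proof (cases "cmod z \<le> ?r")
    case True
    then have "(cmod z)\<^sup>2 \<le> ?r\<^sup>2" by (simp add: power_mono)
    then show ?thesis by (simp add: k_def g_def)
  next
    case False
    then have l: "?r\<^sup>2 \<le> (cmod z)\<^sup>2" by (intro power_mono) auto
    define t where "t = (cmod z)\<^sup>2 - ?r\<^sup>2"
    have "k z = complex_of_real t" "g z = complex_of_real (sqrt t)" "t \<ge> 0"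
      using l by (auto simp: k_def g_def t_def)
    then have 1: "cnj (k z) * k z = complex_of_real (t * t)" "cnj (g z) * g z = complex_of_real t"
      by (simp_all flip: of_real_mult)
    have "cnj (z * g z) * (z * g z) = (z * cnj z) * (cnj (g z) * g z)" by simp
    also have "\<dots> = complex_of_real ((cmod z)\<^sup>2 * t)" unfolding 1 complex_norm_square[symmetric] by simp
    also have "(cmod z)\<^sup>2 * t = t * t + ?r\<^sup>2 * t" by (simp add: t_def algebra_simps)
    finally show ?thesis unfolding 1 by simp
  qed
  then have "gr (\<lambda>x. cnj (f x * g (f x)) * (f x * g (f x)))
      ((op_adjoint K o\<^sub>L K) + op_scaleC (complex_of_real (?r\<^sup>2)) (op_adjoint G o\<^sub>L G))"
    using gr_add[OF gr_mult[OF gr_adjoint[OF K] K]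
        gr_scale[OF gr_mult[OF gr_adjoint[OF G] G], of "complex_of_real (?r\<^sup>2)"]]
    by simp
  then have eq: "(op_adjoint K o\<^sub>L K) + op_scaleC (complex_of_real (?r\<^sup>2)) (op_adjoint G o\<^sub>L G)
      = op_adjoint (R o\<^sub>L G) o\<^sub>L (R o\<^sub>L G)"
    using gr_mult[OF gr_adjoint[OF RG] RG] gr_unique by blast
  have "K = 0"
  proof (rule blinfun_eqI)
    fix y
    have "complex_of_real ((norm (K y))\<^sup>2 + ?r\<^sup>2 * (norm (G y))\<^sup>2) =
       cinner (((op_adjoint K o\<^sub>L K) + op_scaleC (complex_of_real (?r\<^sup>2)) (op_adjoint G o\<^sub>L G)) y) y"
      unfolding of_real_add of_real_mult norm_square_eq_adjoint[OF gr_bounded[OF K]]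
        norm_square_eq_adjoint[OF gr_bounded[OF G]]
      by (simp add: blinfun.add_left cinner_add_left op_scaleC_apply cinner_scaleC_left)
    also have "\<dots> = complex_of_real ((norm ((R o\<^sub>L G) y))\<^sup>2)"
      unfolding eq norm_square_eq_adjoint[OF gr_bounded[OF RG]] ..
    finally have "(norm (K y))\<^sup>2 + ?r\<^sup>2 * (norm (G y))\<^sup>2 = (norm (R (G y)))\<^sup>2"
      by (simp only: of_real_eq_iff blinfun_apply_blinfun_compose)
    moreover have "(norm (R (G y)))\<^sup>2 \<le> (?r * norm (G y))\<^sup>2" by (intro power_mono norm_blinfun) simp
    ultimately have "(norm (K y))\<^sup>2 \<le> 0" unfolding power_mult_distrib by linarith
    then show "K y = blinfun_apply 0 y" by simp
  qed
  then have "k (f x) = 0" using gr_eq_0[OF K] by simp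
  then have "(cmod (f x))\<^sup>2 \<le> ?r\<^sup>2" by (simp add: k_def max_def split: if_splits)
  then show ?thesis by (rule power2_le_imp_le) simp
qed

text \<open>Sending each point to its evaluation moves T onto a compact set in a Hausdorff type; the
  real-valued functions of the algebra become a separating ring there, to which Stone-Weierstrass
  applies.\<close>

lemma approx_real:
  assumes b: "b \<in> Cfun T" and e: "e > 0"
  shows "\<exists>f R. gr f R \<and> (\<forall>x \<in> topspace T. \<bar>Re (b x) - Re (f x)\<bar> < e \<and> Im (f x) = 0)"
proof -
  \<comment> \<open>Coordinates outside \<open>Cfun T\<close> are set to 0, so that every coordinate
    of \<open>ev\<close> is continuous.\<close>
  define ev where "ev = (\<lambda>x f. if f \<in> Cfun T then f x else 0 :: complex)"
  define A where "A = {g. \<exists>f R. gr f R \<and> (\<forall>x \<in> topspace T. g (ev x) = Re (f x) \<and> Im (f x) = 0)}"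
  have "continuous_map T euclidean ev"
    unfolding euclidean_product_topology[symmetric] continuous_map_componentwise_UNIV ev_def
    by (auto intro: Cfun_cont)
  then have cpt: "compact (ev ` topspace T)"
    using compact_T image_compactin[of T "topspace T" euclidean ev]
    by (simp add: compact_space_def)
  have cont: "continuous_on (ev ` topspace T) (\<lambda>y. Re (y f))" for f
    by (rule continuous_on_Re) (rule continuous_on_subset[OF continuous_on_product_coordinates subset_UNIV])
  have ev_apply: "ev x f = f x" if "f \<in> Cfun T" for f x using that by (simp add: ev_def)
  have A_I: "g \<in> A" if "gr f R" "\<And>x. x \<in> topspace T \<Longrightarrow> g (ev x) = Re (f x) \<and> Im (f x) = 0" for g f R
    unfolding A_def using that by blast
  interpret function_ring_on A "ev ` topspace T"
  proof
    show "compact (ev ` topspace T)" by (rule cpt)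
  next
    fix g assume "g \<in> A"
    then obtain f R where f: "gr f R" and g: "\<forall>x \<in> topspace T. g (ev x) = Re (f x)" by (auto simp: A_def)
    have "g y = Re (y f)" if "y \<in> ev ` topspace T" for y
      using that g ev_apply[OF gr_Cfun[OF f]] by auto
    then show "continuous_on (ev ` topspace T) g" using cont[of f] by (simp cong: continuous_on_cong)
  next
    fix g g' assume "g \<in> A" "g' \<in> A"
    then obtain f R f' R' where f: "gr f R" "gr f' R'"
      "\<forall>x \<in> topspace T. g (ev x) = Re (f x) \<and> Im (f x) = 0"
      "\<forall>x \<in> topspace T. g' (ev x) = Re (f' x) \<and> Im (f' x) = 0" by (auto simp: A_def)
    show "(\<lambda>x. g x + g' x) \<in> A" by (rule A_I[OF gr_add[OF f(1,2)]]) (use f in auto)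
    show "(\<lambda>x. g x * g' x) \<in> A" by (rule A_I[OF gr_mult[OF f(1,2)]]) (use f in auto)
  next
    fix c :: real
    obtain P where P: "gr (\<lambda>x. if x \<in> topspace T then 1 else 0) P" using gr_one by blast
    show "(\<lambda>_. c) \<in> A" by (rule A_I[OF gr_scale[OF P, of "complex_of_real c"]]) auto
  next
    fix y y' assume "y \<in> ev ` topspace T" "y' \<in> ev ` topspace T" "y \<noteq> y'"
    then obtain p q where pq: "y = ev p" "y' = ev q" "p \<in> topspace T" "q \<in> topspace T" "p \<noteq> q" by blast
    then obtain f R where f: "gr f R" "f p \<noteq> f q" using separates by blast
    \<comment> \<open>The separating f is complex-valued; its real and imaginary parts stay in the
      algebra by \<open>gr_comp\<close>, and one of them separates.\<close>
    have "continuous_on UNIV (\<lambda>z. complex_of_real (Re z))" "continuous_on UNIV (\<lambda>z. complex_of_real (Im z))"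
      by (intro continuous_intros)+
    then obtain S S' where S: "gr (\<lambda>x. complex_of_real (Re (f x))) S" "gr (\<lambda>x. complex_of_real (Im (f x))) S'"
      using gr_comp[OF f(1), of "\<lambda>z. complex_of_real (Re z)"]
        gr_comp[OF f(1), of "\<lambda>z. complex_of_real (Im z)"]
      by fastforce
    have "(\<lambda>y. Re (y f)) \<in> A" "(\<lambda>y. Im (y f)) \<in> A"
      by (rule A_I[OF S(1)] A_I[OF S(2)]; simp add: ev_apply[OF gr_Cfun[OF f(1)]])+
    moreover have "Re (f p) \<noteq> Re (f q) \<or> Im (f p) \<noteq> Im (f q)" using f(2) by (simp add: complex_eq_iff)
    ultimately show "\<exists>g\<in>A. g y \<noteq> g y'"
      unfolding pq by (metis ev_apply[OF gr_Cfun[OF f(1)]])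
  qed
  obtain g where g: "g \<in> A" "\<forall>y \<in> ev ` topspace T. \<bar>Re (y b) - g y\<bar> < e"
    using Stone_Weierstrass_basic[OF cont e] by blast
  from g(1) obtain f R where "gr f R" "\<forall>x \<in> topspace T. g (ev x) = Re (f x) \<and> Im (f x) = 0"
    by (auto simp: A_def)
  with g(2) ev_apply[OF b] show ?thesis by (metis imageI)
qed

lemma approx:
  assumes b: "b \<in> Cfun T" and e: "e > 0"
  shows "\<exists>f R. gr f R \<and> (\<forall>x. cmod (b x - f x) \<le> e)"
proof -
  have e2: "e / 2 > 0" using e by simp
  obtain f R where f: "gr f R" "\<forall>x \<in> topspace T. \<bar>Re (b x) - Re (f x)\<bar> < e/2 \<and> Im (f x) = 0"
    using approx_real[OF b e2] by blast
  \<comment> \<open>Re (- i b) = Im b, so g approximates the imaginary part.\<close>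
  obtain g S where g: "gr g S"
    "\<forall>x \<in> topspace T. \<bar>Re (- \<i> * b x) - Re (g x)\<bar> < e/2 \<and> Im (g x) = 0"
    using approx_real[OF Cfun_scale[OF b, of "- \<i>"] e2] by blast
  have gr: "gr (\<lambda>x. f x + \<i> * g x) (R + op_scaleC \<i> S)" by (rule gr_add[OF f(1) gr_scale[OF g(1)]])
  have "cmod (b x - (f x + \<i> * g x)) \<le> e" for x
  proof (cases "x \<in> topspace T")
    case True
    have "cmod (b x - (f x + \<i> * g x)) \<le> \<bar>Re (b x - (f x + \<i> * g x))\<bar> + \<bar>Im (b x - (f x + \<i> * g x))\<bar>"
      by (rule cmod_le)
    also have "\<dots> \<le> e / 2 + e / 2" using f(2) g(2) True by (intro add_mono) fastforce+
    finally show ?thesis by simp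
  next
    case False
    then show ?thesis using e Cfun_outside[OF b] Cfun_outside[OF gr_Cfun[OF gr]] by simp
  qed
  with gr show ?thesis by blast
qed

text \<open>Pointwise convergence of the functions suffices, since \<open>gr\<close> is isometric.\<close>

definition rel :: "('b \<Rightarrow> complex) \<Rightarrow> ('h \<Rightarrow>\<^sub>L 'h) \<Rightarrow> bool" where
  "rel b R \<longleftrightarrow> (\<exists>F S. (\<forall>n. gr (F n) (S n)) \<and> S \<longlonglongrightarrow> R \<and> (\<forall>x. (\<lambda>n. F n x) \<longlonglongrightarrow> b x))"

section \<open>Limits of paired functions and operators\<close>

lemma gr_imp_rel: "gr f R \<Longrightarrow> rel f R"
  unfolding rel_def by (intro exI[of _ "\<lambda>_. f"] exI[of _ "\<lambda>_. R"]) simp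

lemma rel_add: "rel f R \<Longrightarrow> rel g S \<Longrightarrow> rel (\<lambda>x. f x + g x) (R + S)"
  unfolding rel_def
proof (elim exE conjE)
  fix F R' G S'
  assume "\<forall>n. gr (F n) (R' n)" "\<forall>n. gr (G n) (S' n)" "R' \<longlonglongrightarrow> R" "S' \<longlonglongrightarrow> S"
    "\<forall>x. (\<lambda>n. F n x) \<longlonglongrightarrow> f x" "\<forall>x. (\<lambda>n. G n x) \<longlonglongrightarrow> g x"
  then show "\<exists>H V. (\<forall>n. gr (H n) (V n)) \<and> V \<longlonglongrightarrow> R + S \<and> (\<forall>x. (\<lambda>n. H n x) \<longlonglongrightarrow> f x + g x)"
    by (intro exI[of _ "\<lambda>n x. F n x + G n x"] exI[of _ "\<lambda>n. R' n + S' n"])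
      (auto intro: gr_add tendsto_intros)
qed

lemma rel_mult: "rel f R \<Longrightarrow> rel g S \<Longrightarrow> rel (\<lambda>x. f x * g x) (R o\<^sub>L S)"
  unfolding rel_def
proof (elim exE conjE)
  fix F R' G S'
  assume "\<forall>n. gr (F n) (R' n)" "\<forall>n. gr (G n) (S' n)" "R' \<longlonglongrightarrow> R" "S' \<longlonglongrightarrow> S"
    "\<forall>x. (\<lambda>n. F n x) \<longlonglongrightarrow> f x" "\<forall>x. (\<lambda>n. G n x) \<longlonglongrightarrow> g x"
  then show "\<exists>H V. (\<forall>n. gr (H n) (V n)) \<and> V \<longlonglongrightarrow> (R o\<^sub>L S) \<and> (\<forall>x. (\<lambda>n. H n x) \<longlonglongrightarrow> f x * g x)"
    by (intro exI[of _ "\<lambda>n x. F n x * G n x"] exI[of _ "\<lambda>n. R' n o\<^sub>L S' n"])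
      (auto intro: gr_mult tendsto_intros bounded_bilinear.tendsto[OF bounded_bilinear_blinfun_compose])
qed

lemma rel_bounded: "rel f R \<Longrightarrow> R \<in> bounded_operators"
  unfolding rel_def
  using closed_sequentially[OF closed_bounded_operators] gr_bounded by blast

lemma rel_scale: "rel f R \<Longrightarrow> rel (\<lambda>x. c * f x) (op_scaleC c R)"
  unfolding rel_def
proof (elim exE conjE)
  fix F R'
  assume *: "\<forall>n. gr (F n) (R' n)" "R' \<longlonglongrightarrow> R" "\<forall>x. (\<lambda>n. F n x) \<longlonglongrightarrow> f x"
  have "(\<lambda>n. op_scaleC c (R' n)) \<longlonglongrightarrow> op_scaleC c R"
    unfolding op_scaleC_def using * by (intro bounded_bilinear.tendsto[OF bounded_bilinear_blinfun_compose] tendsto_intros)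
  with * show "\<exists>H V. (\<forall>n. gr (H n) (V n)) \<and> V \<longlonglongrightarrow> op_scaleC c R \<and> (\<forall>x. (\<lambda>n. H n x) \<longlonglongrightarrow> c * f x)"
    by (intro exI[of _ "\<lambda>n x. c * F n x"] exI[of _ "\<lambda>n. op_scaleC c (R' n)"])
      (auto intro: gr_scale tendsto_intros)
qed

lemma rel_adjoint: assumes "rel f R" shows "rel (\<lambda>x. cnj (f x)) (op_adjoint R)"
proof -
  obtain F R' where *: "\<forall>n. gr (F n) (R' n)" "R' \<longlonglongrightarrow> R" "\<forall>x. (\<lambda>n. F n x) \<longlonglongrightarrow> f x"
    using assms by (auto simp: rel_def)
  have "(\<lambda>n. op_adjoint (R' n)) \<longlonglongrightarrow> op_adjoint R"
  proof (rule LIM_zero_cancel, rule Lim_null_comparison)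
    have "norm (op_adjoint (R' n) - op_adjoint R) \<le> norm (R' n - R)" for n
      using op_adjoint_diff[of "R' n" R] norm_op_adjoint_le[of "R' n - R"] rel_bounded[OF assms]
        gr_bounded *(1) diff_bounded_operators by metis
    then show "\<forall>\<^sub>F n in sequentially. norm (op_adjoint (R' n) - op_adjoint R) \<le> norm (R' n - R)" by simp
    show "(\<lambda>n. norm (R' n - R)) \<longlonglongrightarrow> 0" using *(2) by (simp add: LIM_zero tendsto_norm_zero)
  qed
  with * show ?thesis
    unfolding rel_def by (intro exI[of _ "\<lambda>n x. cnj (F n x)"] exI[of _ "\<lambda>n. op_adjoint (R' n)"])
      (auto intro: gr_adjoint tendsto_intros)
qed

text \<open>By \<open>bounded_by_norm\<close>, |F n x - F m x| is at most the norm of S n - S m for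
  all x at once; letting m tend to infinity turns pointwise into uniform convergence.\<close>

lemma rel_uniform:
  assumes gr: "\<And>n. gr (F n) (S n)" and S: "S \<longlonglongrightarrow> R" and F: "\<And>x. (\<lambda>n. F n x) \<longlonglongrightarrow> b x" and e: "e > 0"
  shows "\<exists>N. \<forall>n\<ge>N. \<forall>x. cmod (F n x - b x) \<le> e"
proof -
  have "Cauchy S" using S by (rule LIMSEQ_imp_Cauchy)
  then obtain N where N: "\<forall>m\<ge>N. \<forall>n\<ge>N. dist (S m) (S n) < e" using e by (auto simp: Cauchy_def)
  have "cmod (F n x - b x) \<le> e" if n: "n \<ge> N" for n x
  proof (rule LIMSEQ_le_const2)
    show "(\<lambda>m. cmod (F n x - F m x)) \<longlonglongrightarrow> cmod (F n x - b x)" using F by (intro tendsto_intros)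
    have "cmod (F n x - F m x) \<le> e" if "m \<ge> N" for m
    proof -
      have "cmod (F n x - F m x) \<le> norm (S n - S m)" by (rule bounded_by_norm[OF gr_diff[OF gr gr]])
      also have "\<dots> \<le> e" using N n that by (force simp: dist_norm)
      finally show ?thesis .
    qed
    then show "\<exists>N. \<forall>m\<ge>N. cmod (F n x - F m x) \<le> e" by blast
  qed
  then show ?thesis by blast
qed

lemma rel_Cfun: assumes "rel b R" shows "b \<in> Cfun T"
proof -
  obtain F S where *: "\<And>n. gr (F n) (S n)" "S \<longlonglongrightarrow> R" "\<And>x. (\<lambda>n. F n x) \<longlonglongrightarrow> b x"
    using assms by (auto simp: rel_def)
  have "continuous_map T Met_TC.mtopology b"
  proof (rule Met_TC.continuous_map_uniform_limit)
    show "\<forall>\<^sub>F n in sequentially. continuous_map T Met_TC.mtopology (F n)"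
      using gr_Cfun[OF *(1)] by (simp add: Cfun_cont)
    fix e :: real assume e: "0 < e"
    then have "e / 2 > 0" by simp
    from rel_uniform[OF * this] obtain N where N: "\<forall>n\<ge>N. \<forall>x. cmod (F n x - b x) \<le> e / 2" by blast
    have "dist (F n x) (b x) < e" if "n \<ge> N" for n x
      using N that e by (smt (verit) dist_norm field_sum_of_halves)
    then show "\<forall>\<^sub>F n in sequentially. \<forall>x \<in> topspace T. b x \<in> UNIV \<and> dist (F n x) (b x) < e"
      by (auto simp: eventually_sequentially)
  qed simp
  moreover have "b x = 0" if "x \<notin> topspace T" for x
    using *(3)[of x] Cfun_outside[OF gr_Cfun[OF *(1)] that] by (simp add: LIMSEQ_const_iff)
  ultimately show ?thesis by (simp add: Cfun_def)
qed

text \<open>Convergence of the functions to 0 is uniform, so \<open>norm_le_if_bounded\<close> sends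
  the operators to 0. Applied to differences, this makes the limit correspondence injective.\<close>

lemma rel_zero_left: assumes "rel (\<lambda>x. 0) R" shows "R = 0"
proof -
  obtain F S where *: "\<And>n. gr (F n) (S n)" "S \<longlonglongrightarrow> R" "\<And>x. (\<lambda>n. F n x) \<longlonglongrightarrow> 0"
    using assms by (auto simp: rel_def)
  have "S \<longlonglongrightarrow> 0"
  proof (rule LIMSEQ_I)
    fix e :: real assume e: "0 < e"
    then have "e / 2 > 0" by simp
    from rel_uniform[OF * this] obtain N where N: "\<forall>n\<ge>N. \<forall>x. cmod (F n x - 0) \<le> e / 2" by blast
    have "norm (S n - 0) < e" if "n \<ge> N" for n
      using norm_le_if_bounded[OF *(1), of "e/2" n] N that e by force
    then show "\<exists>N. \<forall>n\<ge>N. norm (S n - 0) < e" by blast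
  qed
  with *(2) show ?thesis by (rule LIMSEQ_unique)
qed

text \<open>Here \<open>bounded_by_norm\<close> controls the functions by the operators. Applied to
  differences, this makes the function attached to an operator unique.\<close>

lemma rel_zero_right: assumes "rel b 0" shows "b x = 0"
proof -
  obtain F S where *: "\<And>n. gr (F n) (S n)" "S \<longlonglongrightarrow> 0" "\<And>x. (\<lambda>n. F n x) \<longlonglongrightarrow> b x"
    using assms by (auto simp: rel_def)
  have "(\<lambda>n. F n x) \<longlonglongrightarrow> 0"
    by (rule Lim_null_comparison[OF _ tendsto_norm_zero[OF *(2)]]) (simp add: bounded_by_norm[OF *(1)])
  with *(3)[of x] show ?thesis by (rule LIMSEQ_unique)
qed

lemma rel_diff: "rel f R \<Longrightarrow> rel g S \<Longrightarrow> rel (\<lambda>x. f x - g x) (R - S)"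
  using rel_add[OF _ rel_scale[of g S "-1"], of f R] op_scaleC_of_real[of "-1" S] by simp

lemma rel_unique_left: "rel f R \<Longrightarrow> rel f S \<Longrightarrow> R = S"
  using rel_diff[of f R f S] rel_zero_left[of "R - S"] by simp

lemma rel_unique_right: "rel f R \<Longrightarrow> rel g R \<Longrightarrow> f = g"
  using rel_diff[of f R g R] rel_zero_right[of "\<lambda>x. f x - g x"] by fastforce

text \<open>Approximants within 1/(n+1) of b are uniformly Cauchy, so their partners are Cauchy in
  norm by \<open>norm_le_if_bounded\<close>, and the space of operators is complete. This yields
  surjectivity.\<close>

lemma ex_rel_Cfun: assumes b: "b \<in> Cfun T" shows "\<exists>R. rel b R"
proof -
  have "\<exists>f R. gr f R \<and> (\<forall>x. cmod (b x - f x) \<le> 1 / real (Suc n))" for n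
    by (rule approx[OF b]) simp
  then obtain F S where gr: "\<And>n. gr (F n) (S n)" and F: "\<And>n x. cmod (b x - F n x) \<le> 1 / real (Suc n)"
    by metis
  have inv: "(\<lambda>n. 1 / real (Suc n)) \<longlonglongrightarrow> 0"
    using LIMSEQ_inverse_real_of_nat by (simp add: inverse_eq_divide)
  have "(\<lambda>n. F n x) \<longlonglongrightarrow> b x" for x
  proof (rule LIM_zero_cancel, rule Lim_null_comparison[OF _ inv])
    show "\<forall>\<^sub>F n in sequentially. norm (F n x - b x) \<le> 1 / real (Suc n)"
      using F by (simp add: norm_minus_commute)
  qed
  moreover have "Cauchy S"
  proof (rule metric_CauchyI)
    fix e :: real assume e: "e > 0"
    then obtain N where N: "1 / real (Suc N) < e / 2" using nat_approx_posE[of "e/2"] by auto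
    have "dist (S m) (S n) < e" if "m \<ge> N" "n \<ge> N" for m n
    proof -
      have 1: "1 / real (Suc m) \<le> 1 / real (Suc N)" "1 / real (Suc n) \<le> 1 / real (Suc N)"
        using that by (auto simp: frac_le)
      have "cmod (F m x - F n x) \<le> 2 * (1 / real (Suc N))" for x
        using norm_triangle_ineq4[of "b x - F n x" "b x - F m x"] F[of x m] F[of x n] 1 by simp
      then have "norm (S m - S n) \<le> 2 * (1 / real (Suc N))"
        by (intro norm_le_if_bounded[OF gr_diff[OF gr gr]]) auto
      then show ?thesis using N by (simp add: dist_norm)
    qed
    then show "\<exists>N. \<forall>m\<ge>N. \<forall>n\<ge>N. dist (S m) (S n) < e" by blast
  qed
  then obtain R where "S \<longlonglongrightarrow> R" using Cauchy_convergent_iff convergent_def by blast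
  ultimately show ?thesis unfolding rel_def using gr by blast
qed

section \<open>The closed operator algebra and its isomorphism onto C(T)\<close>

definition image_alg :: "('h \<Rightarrow>\<^sub>L 'h) set" where
  "image_alg = closure {R. \<exists>f. gr f R}"

text \<open>An operator in the closure is a limit of partners; \<open>bounded_by_norm\<close> makes
  their functions Cauchy at every point, and the pointwise limit is the function sought.\<close>

lemma image_alg_iff: "R \<in> image_alg \<longleftrightarrow> (\<exists>b. rel b R)"
proof
  assume "R \<in> image_alg"
  then obtain S where S: "\<forall>n. S n \<in> {R. \<exists>f. gr f R}" "S \<longlonglongrightarrow> R"
    unfolding image_alg_def closure_sequential by blast
  then obtain F where gr: "\<And>n. gr (F n) (S n)" by (simp, metis)
  have "Cauchy (\<lambda>n. F n x)" for x
  proof (rule metric_CauchyI)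
    fix e :: real assume e: "e > 0"
    have "Cauchy S" using S(2) by (rule LIMSEQ_imp_Cauchy)
    then obtain N where N: "\<forall>m\<ge>N. \<forall>n\<ge>N. dist (S m) (S n) < e" using e by (auto simp: Cauchy_def)
    have "dist (F m x) (F n x) < e" if "m \<ge> N" "n \<ge> N" for m n
    proof -
      have "cmod (F m x - F n x) \<le> norm (S m - S n)" by (rule bounded_by_norm[OF gr_diff[OF gr gr]])
      then show ?thesis using N that by (force simp: dist_norm)
    qed
    then show "\<exists>N. \<forall>m\<ge>N. \<forall>n\<ge>N. dist (F m x) (F n x) < e" by blast
  qed
  then have "\<forall>x. \<exists>l. (\<lambda>n. F n x) \<longlonglongrightarrow> l" using Cauchy_convergent_iff convergent_def by blast
  then show "\<exists>b. rel b R" unfolding rel_def using gr S(2) by metis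
next
  assume "\<exists>b. rel b R"
  then show "R \<in> image_alg" unfolding rel_def image_alg_def closure_sequential by blast
qed

lemma cstar_subalgebra_image_alg: "cstar_subalgebra image_alg"
  unfolding cstar_subalgebra_def
proof (intro conjI)
  show "closed image_alg" by (simp add: image_alg_def)
  show "0 \<in> image_alg" unfolding image_alg_iff using gr_imp_rel[OF gr_zero] by blast
  show "image_alg \<subseteq> bounded_operators" unfolding subset_iff image_alg_iff using rel_bounded by blast
  show "\<forall>S\<in>image_alg. \<forall>T\<in>image_alg. S + T \<in> image_alg"
    unfolding Ball_def image_alg_iff using rel_add by blast
  show "\<forall>c. \<forall>S\<in>image_alg. op_scaleC c S \<in> image_alg"
    unfolding Ball_def image_alg_iff using rel_scale by blast
  show "\<forall>S\<in>image_alg. \<forall>T\<in>image_alg. S o\<^sub>L T \<in> image_alg"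
    unfolding Ball_def image_alg_iff using rel_mult by blast
  show "\<forall>S\<in>image_alg. op_adjoint S \<in> image_alg"
    unfolding Ball_def image_alg_iff using rel_adjoint by blast
qed

text \<open>The choice in \<Phi> is harmless because an operator has only one related function. The
  clause on \<open>gr\<close> will yield the explicit formula on finite sums.\<close>

lemma star_isomorphism_image_alg:
  "\<exists>\<Phi>. star_isomorphism image_alg T \<Phi> \<and> (\<forall>f R. gr f R \<longrightarrow> \<Phi> R = f)"
proof -
  define \<Phi> where "\<Phi> = (\<lambda>R. SOME b. rel b R)"
  have \<Phi>: "\<Phi> R = b" if "rel b R" for b R
    using rel_unique_right someI[of "\<lambda>b. rel b R", OF that] that unfolding \<Phi>_def by blast
  have rel\<Phi>: "rel (\<Phi> R) R" if "R \<in> image_alg" for R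
    using that \<Phi> image_alg_iff by metis
  have "bij_betw \<Phi> image_alg (Cfun T)"
  proof (rule bij_betw_imageI)
    show "inj_on \<Phi> image_alg" by (rule inj_onI) (metis rel\<Phi> rel_unique_left)
    show "\<Phi> ` image_alg = Cfun T"
      using ex_rel_Cfun \<Phi> image_alg_iff rel_Cfun rel\<Phi> by (fastforce simp: image_iff)
  qed
  then have "star_isomorphism image_alg T \<Phi>"
    unfolding star_isomorphism_def
    using \<Phi>[OF rel_add[OF rel\<Phi> rel\<Phi>]] \<Phi>[OF rel_scale[OF rel\<Phi>]] \<Phi>[OF rel_mult[OF rel\<Phi> rel\<Phi>]]
      \<Phi>[OF rel_adjoint[OF rel\<Phi>]] by (intro conjI ballI allI) simp_all
  then show ?thesis using \<Phi> gr_imp_rel by blast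
qed

end

section \<open>The extension of a partial dynamical system\<close>

text \<open>A condition on neighbouring coordinates that covers finite and infinite chains at once:
  \<open>None\<close> may come only after \<open>None\<close> or after a point without preimage.
  Being local, it exhibits the extension as an intersection of closed sets.\<close>

definition follows :: "'a set \<Rightarrow> ('a \<Rightarrow> 'a) \<Rightarrow> 'a option \<Rightarrow> 'a option \<Rightarrow> bool" where
  "follows D \<alpha> p q \<longleftrightarrow> (case q of None \<Rightarrow> p \<notin> Some ` \<alpha> ` D | Some v \<Rightarrow> v \<in> D \<and> p = Some (\<alpha> v))"

definition ext_points :: "'a topology \<Rightarrow> 'a set \<Rightarrow> ('a \<Rightarrow> 'a) \<Rightarrow> (nat \<Rightarrow> 'a option) set" where
  "ext_points X D \<alpha> = {x. x 0 \<in> Some ` topspace X \<and> (\<forall>n. follows D \<alpha> (x n) (x (Suc n)))}"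

lemma ext_points_Some_Suc:
  assumes "x \<in> ext_points X D \<alpha>" "x (Suc n) = Some v"
  shows "v \<in> D" "x n = Some (\<alpha> v)"
proof -
  have "follows D \<alpha> (x n) (x (Suc n))" using assms(1) by (simp add: ext_points_def)
  then have "follows D \<alpha> (x n) (Some v)" unfolding assms(2) .
  then show "v \<in> D" "x n = Some (\<alpha> v)" by (simp_all add: follows_def)
qed

lemma ext_points_None_mono:
  assumes "x \<in> ext_points X D \<alpha>" "x n = None" "n \<le> m"
  shows "x m = None"
  using assms(3,2)
proof (induction m rule: dec_induct)
  case (step m)
  then show ?case using ext_points_Some_Suc[OF assms(1)] by (cases "x (Suc m)") auto
qed

lemma ext_points_iter_domain:
  assumes "x \<in> ext_points X D \<alpha>" "x n = Some v"
  shows "v \<in> iter_domain X D \<alpha> n"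
  using assms(2)
proof (induction n arbitrary: v)
  case 0
  then show ?case using assms(1) by (auto simp: ext_points_def)
next
  case (Suc n)
  then show ?case using ext_points_Some_Suc[OF assms(1)] by auto
qed

text \<open>Both kinds of chains obey the local rule; conversely a chain without \<open>None\<close>
  is infinite, and otherwise its first \<open>None\<close> marks where it ends.\<close>

lemma ext_points_eq:
  "(\<Union>N. ext_finite X D \<alpha> N) \<union> ext_infinite X D \<alpha> = ext_points X D \<alpha>"
proof (intro equalityI subsetI)
  fix x assume "x \<in> (\<Union>N. ext_finite X D \<alpha> N) \<union> ext_infinite X D \<alpha>"
  then show "x \<in> ext_points X D \<alpha>"
  proof
    assume "x \<in> (\<Union>N. ext_finite X D \<alpha> N)"
    then obtain N y where x: "x = (\<lambda>n. if n \<le> N then Some (y n) else None)"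
      and y: "\<forall>n\<le>N. y n \<in> iter_domain X D \<alpha> n" "y N \<notin> \<alpha> ` D"
      "\<forall>n. 1 \<le> n \<and> n \<le> N \<longrightarrow> \<alpha> (y n) = y (n - 1)"
      unfolding ext_finite_def by blast
    have "follows D \<alpha> (x n) (x (Suc n))" for n
    proof (cases "Suc n \<le> N")
      case True
      then show ?thesis using y(1)[rule_format, OF True] y(3)[rule_format, of "Suc n"]
        by (simp add: x follows_def)
    next
      case False
      then show ?thesis using y(2) by (cases "n = N") (auto simp: x follows_def)
    qed
    then show ?thesis using y(1)[rule_format, of 0] by (simp add: ext_points_def x)
  next
    assume "x \<in> ext_infinite X D \<alpha>"
    then obtain y where x: "x = (\<lambda>n. Some (y n))"
      and y: "\<forall>n. y n \<in> iter_domain X D \<alpha> n" "\<forall>n\<ge>1. \<alpha> (y n) = y (n - 1)"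
      unfolding ext_infinite_def by blast
    have "follows D \<alpha> (x n) (x (Suc n))" for n
      using y(1)[rule_format, of "Suc n"] y(2)[rule_format, of "Suc n"] by (simp add: x follows_def)
    then show ?thesis using y(1)[rule_format, of 0] by (simp add: ext_points_def x)
  qed
next
  fix x assume x: "x \<in> ext_points X D \<alpha>"
  define y where "y = (\<lambda>n. the (x n))"
  show "x \<in> (\<Union>N. ext_finite X D \<alpha> N) \<union> ext_infinite X D \<alpha>"
  proof (cases "\<exists>n. x n = None")
    case False
    then have xy: "x n = Some (y n)" for n by (simp add: y_def)
    have "\<forall>n. y n \<in> iter_domain X D \<alpha> n" using ext_points_iter_domain[OF x xy] by blast
    moreover have "\<alpha> (y n) = y (n - 1)" if "n \<ge> 1" for n
      using ext_points_Some_Suc(2)[OF x, of "n - 1" "y n"] xy[of n] xy[of "n - 1"] that by simp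
    ultimately have "x \<in> ext_infinite X D \<alpha>"
      unfolding ext_infinite_def using xy by blast
    then show ?thesis by blast
  next
    case True
    \<comment> \<open>\<open>x 0\<close> is never \<open>None\<close>, so the first
      \<open>None\<close> sits at M = Suc N; the local rule at that place says that the last point
      has no preimage.\<close>
    define M where "M = (LEAST n. x n = None)"
    have M: "x M = None" using True unfolding M_def by (rule LeastI_ex)
    have less: "x n \<noteq> None" if "n < M" for n using that not_less_Least unfolding M_def by blast
    have "M \<noteq> 0" using M x by (intro notI) (auto simp: ext_points_def)
    then obtain N where N: "M = Suc N" using not0_implies_Suc by blast
    have xy: "x n = Some (y n)" if "n \<le> N" for n using less[of n] that N by (simp add: y_def)
    have "x n = None" if "n > N" for n using ext_points_None_mono[OF x M] that N by simp
    then have "x = (\<lambda>n. if n \<le> N then Some (y n) else None)" using xy by (auto simp: fun_eq_iff)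
    moreover have "\<forall>n\<le>N. y n \<in> iter_domain X D \<alpha> n" using ext_points_iter_domain[OF x xy] by blast
    moreover have "y N \<notin> \<alpha> ` D"
    proof -
      have "follows D \<alpha> (x N) (x (Suc N))" using x by (simp add: ext_points_def)
      then show ?thesis using M N xy[of N] by (auto simp: follows_def)
    qed
    moreover have "\<alpha> (y n) = y (n - 1)" if "1 \<le> n \<and> n \<le> N" for n
    proof -
      have "x n = Some (y n)" "x (n - 1) = Some (y (n - 1))" using that by (auto intro!: xy)
      then show ?thesis using ext_points_Some_Suc(2)[OF x, of "n - 1" "y n"] that by simp
    qed
    ultimately have "x \<in> ext_finite X D \<alpha> N" unfolding ext_finite_def by blast
    then show ?thesis by blast
  qed
qed

text \<open>Below index n the coordinates are forced by \<alpha>; beyond n a preimage is chosen as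
  long as one exists. Thus every value of a coefficient on its iterated domain is seen at some point
  of the extension.\<close>

lemma ex_ext_point:
  assumes v: "v \<in> iter_domain X D \<alpha> n" and D: "D \<subseteq> topspace X"
  obtains x where "x \<in> ext_points X D \<alpha>" "x n = Some v"
proof -
  \<comment> \<open>\<open>pre\<close> maps \<open>None\<close> to itself, so a chain that has
    stopped stays stopped.\<close>
  define pre where "pre = (\<lambda>p. if p \<in> Some ` \<alpha> ` D then Some (SOME w. w \<in> D \<and> p = Some (\<alpha> w)) else None)"
  have pre: "follows D \<alpha> p (pre p)" for p
  proof (cases "p \<in> Some ` \<alpha> ` D")
    case True
    then have "\<exists>w. w \<in> D \<and> p = Some (\<alpha> w)" by blast
    from someI_ex[OF this] True show ?thesis by (simp add: pre_def follows_def)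
  qed (simp add: pre_def follows_def)
  have vX: "v \<in> topspace X" using v D by (cases n) auto
  define z where "z = (\<lambda>k. (pre ^^ k) (Some v))"
  have z: "z \<in> ext_points X D \<alpha>" "z 0 = Some v"
    using vX pre by (auto simp: z_def ext_points_def)
  have "\<exists>x \<in> ext_points X D \<alpha>. \<forall>k. x (n + k) = z k"
    using v z
  proof (induction n arbitrary: v z)
    case 0
    then show ?case by auto
  next
    case (Suc n)
    define z' where "z' = case_nat (Some (\<alpha> v)) z"
    have v: "v \<in> D" "\<alpha> v \<in> iter_domain X D \<alpha> n" using Suc.prems by auto
    have "\<alpha> v \<in> topspace X" using v(2) D by (cases n) auto
    then have "z' \<in> ext_points X D \<alpha>" "z' 0 = Some (\<alpha> v)"
      using Suc.prems(2,3) v(1)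
      by (auto simp: z'_def ext_points_def follows_def split: nat.split)
    from Suc.IH[OF v(2) this] obtain x where x: "x \<in> ext_points X D \<alpha>" "\<forall>k. x (n + k) = z' k" by blast
    have "x (Suc n + k) = z k" for k using x(2)[rule_format, of "Suc k"] by (simp add: z'_def)
    with x(1) show ?case by blast
  qed
  then show ?thesis using that z(2) by (metis add.right_neutral)
qed

section \<open>Topology of X with an isolated point added\<close>

lemma topspace_adjoin: "topspace (adjoin_isolated_point X) = insert None (Some ` topspace X)"
proof -
  have "openin (adjoin_isolated_point X) (insert None (Some ` topspace X))"
    by (simp add: openin_adjoin_isolated_point image_iff)
  then show ?thesis
    using openin_topspace[of "adjoin_isolated_point X"]
    unfolding openin_adjoin_isolated_point
    by (intro equalityI) (simp, rule openin_subset, simp add: openin_adjoin_isolated_point)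
qed

lemma topspace_alpha_extension:
  assumes "D \<subseteq> topspace X" "\<alpha> ` D \<subseteq> topspace X"
  shows "topspace (alpha_extension X D \<alpha>) = ext_points X D \<alpha>"
proof -
  have "x n \<in> insert None (Some ` topspace X)" if "x \<in> ext_points X D \<alpha>" for x n
    using ext_points_iter_domain[OF that, of n] assms by (cases "x n"; cases n) auto
  then have "ext_points X D \<alpha> \<subseteq> topspace (product_topology (\<lambda>_. adjoin_isolated_point X) UNIV)"
    by (auto simp: topspace_adjoin)
  then show ?thesis unfolding alpha_extension_def ext_points_eq topspace_subtopology by blast
qed

lemma openin_adjoin_Some: "openin X V \<Longrightarrow> openin (adjoin_isolated_point X) (Some ` V)"
  using openin_subset[of X V] by (auto simp: openin_adjoin_isolated_point image_iff)

lemma openin_adjoin_None: "openin (adjoin_isolated_point X) {None}"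
  by (simp add: openin_adjoin_isolated_point)

lemma continuous_map_Some: "continuous_map X (adjoin_isolated_point X) Some"
  unfolding continuous_map_def topspace_adjoin
proof (intro conjI allI impI)
  fix W assume W: "openin (adjoin_isolated_point X) W"
  then have "openin X {x. Some x \<in> W}" by (simp add: openin_adjoin_isolated_point)
  moreover have "{x \<in> topspace X. Some x \<in> W} = {x. Some x \<in> W}"
    using openin_subset[OF \<open>openin X {x. Some x \<in> W}\<close>] by blast
  ultimately show "openin X {x \<in> topspace X. Some x \<in> W}" by simp
qed auto

lemma continuous_map_adjoin:
  assumes f: "continuous_map X Y (\<lambda>x. f (Some x))" and n: "f None \<in> topspace Y"
  shows "continuous_map (adjoin_isolated_point X) Y f"
  unfolding continuous_map_def topspace_adjoin
proof (intro conjI allI impI)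
  show "f \<in> insert None (Some ` topspace X) \<rightarrow> topspace Y"
    using continuous_map_funspace[OF f] n by auto
  fix V assume "openin Y V"
  then have "openin X {x \<in> topspace X. f (Some x) \<in> V}" using f by (simp add: continuous_map_def)
  moreover have "{x. Some x \<in> {p \<in> insert None (Some ` topspace X). f p \<in> V}} = {x \<in> topspace X. f (Some x) \<in> V}"
    by auto
  ultimately show "openin (adjoin_isolated_point X) {p \<in> insert None (Some ` topspace X). f p \<in> V}"
    unfolding openin_adjoin_isolated_point by (intro conjI) (blast, simp only:)
qed

lemma compact_space_adjoin:
  assumes "compact_space X" shows "compact_space (adjoin_isolated_point X)"
proof -
  have "compactin (adjoin_isolated_point X) (Some ` topspace X)"
    using image_compactin[OF _ continuous_map_Some] assms by (simp add: compact_space_def)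
  moreover have "compactin (adjoin_isolated_point X) {None}"
    by (simp add: topspace_adjoin)
  ultimately have "compactin (adjoin_isolated_point X) ({None} \<union> Some ` topspace X)"
    by (intro compactin_Un)
  then show ?thesis by (simp add: compact_space_def topspace_adjoin)
qed

lemma Hausdorff_space_adjoin:
  assumes "Hausdorff_space X" shows "Hausdorff_space (adjoin_isolated_point X)"
  unfolding Hausdorff_space_def
proof (intro allI impI, elim conjE)
  have SN: "\<exists>U V. openin (adjoin_isolated_point X) U \<and> openin (adjoin_isolated_point X) V \<and>
     Some u \<in> U \<and> None \<in> V \<and> disjnt U V" if "u \<in> topspace X" for u
    using that openin_adjoin_Some[OF openin_topspace, of X] openin_adjoin_None[of X]
    by (intro exI[of _ "Some ` topspace X"] exI[of _ "{None}"]) (auto simp: disjnt_def)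
  fix p q
  assume pq: "p \<in> topspace (adjoin_isolated_point X)" "q \<in> topspace (adjoin_isolated_point X)" "p \<noteq> q"
  show "\<exists>U V. openin (adjoin_isolated_point X) U \<and> openin (adjoin_isolated_point X) V \<and>
     p \<in> U \<and> q \<in> V \<and> disjnt U V"
  proof (cases p)
    case None
    then obtain u where "q = Some u" "u \<in> topspace X" using pq by (auto simp: topspace_adjoin)
    then show ?thesis using SN[of u] None disjnt_sym by blast
  next
    case (Some u)
    then have u: "u \<in> topspace X" using pq by (auto simp: topspace_adjoin)
    show ?thesis
    proof (cases q)
      case None
      then show ?thesis using SN[OF u] Some by blast
    next
      fix v assume v: "q = Some v"
      then have "v \<in> topspace X" "u \<noteq> v" using pq Some by (auto simp: topspace_adjoin)
      then obtain U V where "openin X U" "openin X V" "u \<in> U" "v \<in> V" "disjnt U V"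
        using assms u unfolding Hausdorff_space_def by blast
      then show ?thesis
        using Some v openin_adjoin_Some[of X U] openin_adjoin_Some[of X V]
        by (intro exI[of _ "Some ` U"] exI[of _ "Some ` V"]) (auto simp: disjnt_def)
    qed
  qed
qed

section \<open>Clopen domain and range, compactness of the extension\<close>

locale partial_system =
  fixes X :: "'a topology" and D :: "'a set" and \<alpha> :: "'a \<Rightarrow> 'a"
  assumes sys: "partial_dynamical_system X D \<alpha>"
begin

lemma compact_X: "compact_space X" and Hausdorff_X: "Hausdorff_space X"
  and open_D: "openin X D" and closed_D: "closedin X D"
  and cont_\<alpha>: "continuous_map (subtopology X D) X \<alpha>" and open_image: "openin X (\<alpha> ` D)"
  using sys by (simp_all add: partial_dynamical_system_def)

lemma D_subset: "D \<subseteq> topspace X" and image_subset: "\<alpha> ` D \<subseteq> topspace X"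
  using open_D open_image by (simp_all add: openin_subset)

text \<open>D is compact, being closed in X, so its continuous image is compact in a Hausdorff
  space. Together with openness this puts the indicator of \<alpha>(D) into C(X).\<close>

lemma closed_image: "closedin X (\<alpha> ` D)"
proof -
  have "compactin (subtopology X D) D"
    using closedin_compact_space[OF compact_X closed_D] by (simp add: compactin_subtopology)
  then have "compactin X (\<alpha> ` D)" using cont_\<alpha> by (rule image_compactin)
  then show ?thesis by (rule compactin_imp_closedin[OF Hausdorff_X])
qed

lemma topspace_ext: "topspace (alpha_extension X D \<alpha>) = ext_points X D \<alpha>"
  using D_subset image_subset by (rule topspace_alpha_extension)

lemma continuous_map_if_clopen:
  assumes K: "openin X K" "closedin X K"
    and f: "continuous_map (subtopology X K) Y f" and c: "c \<in> topspace Y"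
  shows "continuous_map X Y (\<lambda>x. if x \<in> K then f x else c)"
proof (rule continuous_map_cases)
  have KX: "K \<subseteq> topspace X" using K by (simp add: openin_subset)
  show "continuous_map (subtopology X (X closure_of {x. x \<in> K})) Y f"
    using f K by (simp add: closure_of_closedin)
  show "continuous_map (subtopology X (X closure_of {x. x \<notin> K})) Y (\<lambda>x. c)"
    using c by simp
  fix x assume "x \<in> X frontier_of {x. x \<in> K}"
  then show "f x = c" using K frontier_of_eq_empty[OF KX] by simp
qed

lemma continuous_map_indicator:
  assumes K: "openin X K" "closedin X K"
  shows "(\<lambda>x. if x \<in> K then 1 else 0) \<in> Cfun X"
  using continuous_map_if_clopen[OF K, of euclidean "\<lambda>_. 1" "0 :: complex"] openin_subset[OF K(1)]
  by (auto simp: Cfun_def)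

lemma Cfun_induced_endo:
  assumes "a \<in> Cfun X" shows "induced_endo D \<alpha> a \<in> Cfun X"
proof -
  have "continuous_map (subtopology X D) euclidean (\<lambda>x. a (\<alpha> x))"
    using continuous_map_compose[OF cont_\<alpha> Cfun_cont[OF assms]] by (simp add: o_def)
  from continuous_map_if_clopen[OF open_D closed_D this, of 0] show ?thesis
    using D_subset by (auto simp: Cfun_def induced_endo_def)
qed

text \<open>Each local rule is closed: either the next coordinate is \<open>None\<close> and the
  present one avoids the open set \<alpha>(D), or the next one lies in the clopen set D and is
  mapped to the present one, an equality of continuous maps into a Hausdorff space.\<close>

lemma closedin_ext_points:
  "closedin (product_topology (\<lambda>_. adjoin_isolated_point X) UNIV) (ext_points X D \<alpha>)"
proof -
  let ?Y = "adjoin_isolated_point X" and ?P = "product_topology (\<lambda>_::nat. adjoin_isolated_point X) UNIV"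
  \<comment> \<open>\<gamma> is \<alpha> on the enlarged space, with value \<open>None\<close> off
    D; it is continuous everywhere because D is clopen.\<close>
  define \<gamma> where "\<gamma> = (\<lambda>p. case p of None \<Rightarrow> None | Some v \<Rightarrow> if v \<in> D then Some (\<alpha> v) else None)"
  have "continuous_map (subtopology X D) ?Y (\<lambda>v. Some (\<alpha> v))"
    using continuous_map_compose[OF cont_\<alpha> continuous_map_Some] by (simp add: o_def)
  from continuous_map_if_clopen[OF open_D closed_D this, of None]
  have \<gamma>: "continuous_map ?Y ?Y \<gamma>"
    by (intro continuous_map_adjoin) (auto simp: \<gamma>_def topspace_adjoin)
  have pr: "continuous_map ?P ?Y (\<lambda>x. x n)" for n
    by (rule continuous_map_product_projection) simp
  have cl: "closedin ?P {x \<in> topspace ?P. x n \<in> K}" if "openin ?Y (topspace ?Y - K)" for n K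
  proof -
    have "closedin ?Y (topspace ?Y \<inter> K)" using that by (simp add: closedin_def Diff_Int)
    from closedin_continuous_map_preimage[OF pr this] 
    have "closedin ?P {x \<in> topspace ?P. x n \<in> topspace ?Y \<inter> K}" .
    moreover have "{x \<in> topspace ?P. x n \<in> topspace ?Y \<inter> K} = {x \<in> topspace ?P. x n \<in> K}"
      by (auto simp: PiE_iff)
    ultimately show ?thesis by simp
  qed
  have H: "Hausdorff_space ?Y" by (rule Hausdorff_space_adjoin[OF Hausdorff_X])
  have 0: "closedin ?P {x \<in> topspace ?P. x 0 \<in> Some ` topspace X}"
  proof (rule cl)
    have "topspace ?Y - Some ` topspace X = {None}" by (auto simp: topspace_adjoin)
    then show "openin ?Y (topspace ?Y - Some ` topspace X)" using openin_adjoin_None[of X] by simp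
  qed
  have 1: "closedin ?P {x \<in> topspace ?P. x (Suc n) \<in> {None}}" for n
  proof (rule cl)
    have "topspace ?Y - {None} = Some ` topspace X" by (auto simp: topspace_adjoin)
    then show "openin ?Y (topspace ?Y - {None})" using openin_adjoin_Some[of X "topspace X"] by simp
  qed
  have 2: "closedin ?P {x \<in> topspace ?P. x n \<in> - (Some ` \<alpha> ` D)}" for n
  proof (rule cl)
    have "topspace ?Y - - (Some ` \<alpha> ` D) = Some ` (\<alpha> ` D)" using image_subset by (auto simp: topspace_adjoin)
    then show "openin ?Y (topspace ?Y - - (Some ` \<alpha> ` D))" using openin_adjoin_Some[OF open_image] by simp
  qed
  have 3: "closedin ?P {x \<in> topspace ?P. x (Suc n) \<in> Some ` D}" for n
  proof (rule cl)
    have "topspace ?Y - Some ` D = {None} \<union> Some ` (topspace X - D)" by (auto simp: topspace_adjoin)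
    then show "openin ?Y (topspace ?Y - Some ` D)"
      using openin_Un[OF openin_adjoin_None[of X] openin_adjoin_Some[of X "topspace X - D"]] closed_D
      by (simp add: closedin_def)
  qed
  have "continuous_map ?P ?Y (\<lambda>x. \<gamma> (x (Suc n)))" for n
    using continuous_map_compose[OF pr \<gamma>] by (simp add: o_def)
  then have 4: "closedin ?P {x \<in> topspace ?P. \<gamma> (x (Suc n)) = x n}" for n
    by (rule closedin_continuous_maps_eq[OF H _ pr])
  have foll: "closedin ?P {x \<in> topspace ?P. follows D \<alpha> (x n) (x (Suc n))}" for n
  proof -
    have "follows D \<alpha> p q \<longleftrightarrow> q \<in> {None} \<and> p \<in> - (Some ` \<alpha> ` D) \<or> q \<in> Some ` D \<and> \<gamma> q = p" for p q
      by (cases q) (auto simp: follows_def \<gamma>_def)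
    then have "{x \<in> topspace ?P. follows D \<alpha> (x n) (x (Suc n))} =
        ({x \<in> topspace ?P. x (Suc n) \<in> {None}} \<inter> {x \<in> topspace ?P. x n \<in> - (Some ` \<alpha> ` D)})
      \<union> ({x \<in> topspace ?P. x (Suc n) \<in> Some ` D} \<inter> {x \<in> topspace ?P. \<gamma> (x (Suc n)) = x n})"
      by blast
    moreover have "closedin ?P \<dots>"
      by (intro closedin_Un closedin_Int 1 2 3 4)
    ultimately show ?thesis by simp
  qed
  have "ext_points X D \<alpha> \<subseteq> topspace ?P"
    using topspace_ext unfolding alpha_extension_def topspace_subtopology by (metis inf_le1)
  then have "ext_points X D \<alpha> = {x \<in> topspace ?P. x 0 \<in> Some ` topspace X}
      \<inter> (\<Inter>n. {x \<in> topspace ?P. follows D \<alpha> (x n) (x (Suc n))})"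
    by (auto simp: ext_points_def)
  moreover have "closedin ?P (\<Inter>n. {x \<in> topspace ?P. follows D \<alpha> (x n) (x (Suc n))})"
    using foll by (intro closedin_INT) auto
  ultimately show ?thesis using 0 by (simp only:) (intro closedin_Int)
qed

lemma compact_space_ext: "compact_space (alpha_extension X D \<alpha>)"
  unfolding alpha_extension_def ext_points_eq
  using closedin_ext_points compact_space_adjoin[OF compact_X]
  by (intro compact_space_subtopology closedin_compact_space) (auto simp: compact_space_product_topology)

lemma continuous_map_ext_coordinate:
  "continuous_map (alpha_extension X D \<alpha>) (adjoin_isolated_point X) (\<lambda>x. x n)"
  unfolding alpha_extension_def
  by (rule continuous_map_from_subtopology, rule continuous_map_product_projection) simp

lemma continuous_map_eval0: "a \<in> Cfun X \<Longrightarrow> continuous_map (adjoin_isolated_point X) euclidean (eval0 a)"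
  by (rule continuous_map_adjoin) (auto simp: eval0_def Cfun_cont)

lemma ex_Cfun_separating:
  assumes "u \<in> topspace X" "v \<in> topspace X" "u \<noteq> v"
  obtains a where "a \<in> Cfun X" "a u \<noteq> a v"
proof -
  have "normal_space X" using compact_X Hausdorff_X compact_Hausdorff_or_regular_imp_normal_space by blast
  moreover have "closedin X {u}" "closedin X {v}"
    using assms Hausdorff_X by (auto intro: closedin_Hausdorff_singleton)
  ultimately obtain f :: "'a \<Rightarrow> real" where f: "continuous_map X euclideanreal f" "f ` {u} \<subseteq> {0}" "f ` {v} \<subseteq> {1}"
    using Urysohn_lemma_alt[of X "{u}" "{v}" 0 1] assms(3) by (metis disjnt_insert1 disjnt_empty1 singletonD)
  define a where "a = (\<lambda>x. if x \<in> topspace X then complex_of_real (f x) else 0)"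
  have "continuous_map X euclidean (\<lambda>x. complex_of_real (f x))"
    using continuous_map_compose[OF f(1), of euclidean complex_of_real] by (simp add: o_def continuous_map_iff_continuous2)
  then have "a \<in> Cfun X"
    unfolding Cfun_def a_def by (auto intro: continuous_map_eq)
  moreover have "a u \<noteq> a v" using f assms by (simp add: a_def)
  ultimately show ?thesis using that by blast
qed

end

section \<open>Covariant representations\<close>

abbreviation ind :: "'a set \<Rightarrow> 'a \<Rightarrow> complex" where
  "ind K \<equiv> \<lambda>x. if x \<in> K then 1 else 0"

lemma induced_endo_cnj: "induced_endo D \<alpha> (\<lambda>x. cnj (a x)) = (\<lambda>x. cnj (induced_endo D \<alpha> a x))"
  and induced_endo_zero: "induced_endo D \<alpha> (\<lambda>x. 0) = (\<lambda>x. 0)"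
  by (auto simp: induced_endo_def)

locale covariant_representation = partial_system X D \<alpha>
  for X :: "'a topology" and D :: "'a set" and \<alpha> :: "'a \<Rightarrow> 'a" +
  fixes \<pi> :: "('a \<Rightarrow> complex) \<Rightarrow> ('h::complex_hilbert_space \<Rightarrow>\<^sub>L 'h)" and U :: "'h \<Rightarrow>\<^sub>L 'h"
  assumes cov: "(\<pi>, U) \<in> CovFaithRep X D \<alpha>"
begin

abbreviation "\<delta> \<equiv> induced_endo D \<alpha>"
abbreviation "Us \<equiv> op_adjoint U"
abbreviation "one \<equiv> ind (topspace X)"

lemma rep: "representation X \<pi>" and pi_inj: "inj_on \<pi> (Cfun X)"
  and U_pi_Us: "a \<in> Cfun X \<Longrightarrow> U o\<^sub>L \<pi> a o\<^sub>L Us = \<pi> (\<delta> a)"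
  and init: "initial_space U = {\<pi> a h | a h. a \<in> Cfun_on (\<alpha> ` D) X}"
  and U_isometry: "x \<in> initial_space U \<Longrightarrow> norm (U x) = norm x"
  and U_bounded: "U \<in> bounded_operators"
  using cov by (auto simp: CovFaithRep_def faithful_representation_def partial_isometry_def)

lemma pi_bounded: "a \<in> Cfun X \<Longrightarrow> \<pi> a \<in> bounded_operators"
  and pi_add: "a \<in> Cfun X \<Longrightarrow> b \<in> Cfun X \<Longrightarrow> \<pi> (\<lambda>x. a x + b x) = \<pi> a + \<pi> b"
  and pi_scale: "a \<in> Cfun X \<Longrightarrow> \<pi> (\<lambda>x. c * a x) = op_scaleC c (\<pi> a)"
  and pi_mult: "a \<in> Cfun X \<Longrightarrow> b \<in> Cfun X \<Longrightarrow> \<pi> (\<lambda>x. a x * b x) = \<pi> a o\<^sub>L \<pi> b"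
  and pi_cnj: "a \<in> Cfun X \<Longrightarrow> \<pi> (\<lambda>x. cnj (a x)) = op_adjoint (\<pi> a)"
  using rep by (auto simp: representation_def)

lemma Us_bounded: "Us \<in> bounded_operators"
  using U_bounded by (rule op_adjoint_bounded)

lemma pi_zero: "\<pi> (\<lambda>x. 0) = 0"
  using pi_add[OF Cfun_zero Cfun_zero] by simp

lemma Cfun_one: "one \<in> Cfun X" and Cfun_ind_D: "ind D \<in> Cfun X"
  and Cfun_ind_image: "ind (\<alpha> ` D) \<in> Cfun X"
  using continuous_map_indicator[OF open_D closed_D] continuous_map_indicator[OF open_image closed_image]
    continuous_map_indicator[OF openin_topspace closedin_topspace] by blast+

lemma one_mult: "a \<in> Cfun X \<Longrightarrow> (\<lambda>x. one x * a x) = a"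
  by (auto simp: Cfun_outside)

lemma induced_endo_one: "\<delta> one = ind D"
  using image_subset by (auto simp: induced_endo_def fun_eq_iff)

text \<open>The initial space is the range of the projection P = \<pi>(i), with i the indicator of
  \<alpha>(D), since i a = a for a supported there. U is isometric on this range and kills its
  complement, which identifies U^*U with P.\<close>

lemma
  shows U_ind_image: "U o\<^sub>L \<pi> (ind (\<alpha> ` D)) = U"
    and Us_U: "Us o\<^sub>L U = \<pi> (ind (\<alpha> ` D))"
proof -
  let ?i = "ind (\<alpha> ` D)"
  let ?P = "\<pi> ?i"
  note i = Cfun_ind_image
  have bP: "?P \<in> bounded_operators" using i by (rule pi_bounded)
  have "(\<lambda>x. ?i x * ?i x) = ?i" "(\<lambda>x. cnj (?i x)) = ?i" by auto
  then have PP: "?P o\<^sub>L ?P = ?P" and Padj: "op_adjoint ?P = ?P"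
    using pi_mult[OF i i] pi_cnj[OF i] by simp_all
  have P_idem: "?P (?P x) = ?P x" for x using arg_cong[OF PP, of "\<lambda>A. blinfun_apply A x"] by simp
  have in_init: "?P x \<in> initial_space U" for x
    unfolding init using i by (auto simp: Cfun_on_def intro!: exI[of _ ?i])
  have init_P: "?P z = z" if z: "z \<in> initial_space U" for z
  proof -
    obtain a h where a: "z = \<pi> a h" "a \<in> Cfun X" "\<forall>x. x \<notin> \<alpha> ` D \<longrightarrow> a x = 0"
      using z unfolding init Cfun_on_def by blast
    have "(\<lambda>x. ?i x * a x) = a" using a(3) by auto
    then have "?P o\<^sub>L \<pi> a = \<pi> a" using pi_mult[OF i a(2)] by simp
    then show ?thesis unfolding a(1) by (metis blinfun_apply_blinfun_compose)
  qed
  have UP: "U (?P x) = U x" for x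
  proof -
    \<comment> \<open>y lies in the kernel of P while U^*U y lies in the initial space, so <U^*U y,
      y> = <U^*U y, P y> = 0.\<close>
    define y where "y = x - ?P x"
    have "Us (U y) \<in> initial_space U"
      by (simp add: initial_space_def cinner_adjoint_left[OF U_bounded])
    then have "cinner (Us (U y)) y = cinner (?P (Us (U y))) y" by (simp add: init_P)
    also have "\<dots> = cinner (Us (U y)) (?P y)"
      using cinner_adjoint_right[OF bP] by (simp add: Padj)
    also have "?P y = 0" by (simp add: y_def blinfun.diff_right P_idem)
    finally have "cinner (U y) (U y) = 0" by (simp add: cinner_adjoint_left[OF U_bounded])
    then have "U y = 0" by (simp add: cinner_self_eq_0_iff)
    then show ?thesis by (simp add: y_def blinfun.diff_right)
  qed
  then show "U o\<^sub>L ?P = U" by (intro blinfun_eqI) simp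
  show "Us o\<^sub>L U = ?P"
  proof (rule cinner_quadratic_eqI)
    show "Us o\<^sub>L U \<in> bounded_operators" by (intro compose_bounded_operators Us_bounded U_bounded)
    show "?P \<in> bounded_operators" by (rule bP)
    fix x
    have "cinner ((Us o\<^sub>L U) x) x = complex_of_real ((norm (U (?P x)))\<^sup>2)"
      unfolding norm_square_eq_adjoint[OF U_bounded, symmetric] UP ..
    also have "\<dots> = complex_of_real ((norm (?P x))\<^sup>2)" by (simp add: U_isometry[OF in_init])
    also have "\<dots> = cinner (?P x) x" unfolding norm_square_eq_adjoint[OF bP] Padj PP ..
    finally show "cinner ((Us o\<^sub>L U) x) x = cinner (?P x) x" .
  qed
qed

text \<open>U^*U = \<pi>(i) commutes with \<pi>(a), so U \<pi>(a) = U \<pi>(a) U^*U, where the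
  covariance relation applies.\<close>

lemma U_pi:
  assumes a: "a \<in> Cfun X" shows "U o\<^sub>L \<pi> a = \<pi> (\<delta> a) o\<^sub>L U"
proof -
  have "U o\<^sub>L \<pi> a = U o\<^sub>L (\<pi> (ind (\<alpha> ` D)) o\<^sub>L \<pi> a)"
    by (metis U_ind_image blinfun_compose_assoc)
  also have "\<pi> (ind (\<alpha> ` D)) o\<^sub>L \<pi> a = \<pi> a o\<^sub>L (Us o\<^sub>L U)"
    unfolding Us_U pi_mult[OF Cfun_ind_image a, symmetric] pi_mult[OF a Cfun_ind_image, symmetric]
    by (simp add: mult.commute)
  also have "U o\<^sub>L (\<pi> a o\<^sub>L (Us o\<^sub>L U)) = (U o\<^sub>L \<pi> a o\<^sub>L Us) o\<^sub>L U"
    by (simp add: blinfun_compose_assoc)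
  finally show ?thesis unfolding U_pi_Us[OF a] .
qed

lemma pi_Us:
  assumes a: "a \<in> Cfun X" shows "\<pi> a o\<^sub>L Us = Us o\<^sub>L \<pi> (\<delta> a)"
proof -
  have "op_adjoint (U o\<^sub>L \<pi> (\<lambda>x. cnj (a x))) = op_adjoint (\<pi> (\<lambda>x. cnj (\<delta> a x)) o\<^sub>L U)"
    using U_pi[OF Cfun_cnj[OF a]] by (simp add: induced_endo_cnj)
  then show ?thesis
    using a U_bounded pi_cnj[OF Cfun_cnj[OF a]] pi_cnj[OF Cfun_cnj[OF Cfun_induced_endo[OF a]]]
    by (simp add: op_adjoint_compose pi_bounded Cfun_cnj Cfun_induced_endo)
qed

text \<open>\<pi>(1) may differ from the identity, but U = U \<pi>(i) and i 1 = i make it a unit to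
  the right of U.\<close>

lemma U_one: "U o\<^sub>L \<pi> one = U"
proof -
  have "U o\<^sub>L \<pi> one = U o\<^sub>L (\<pi> (ind (\<alpha> ` D)) o\<^sub>L \<pi> one)"
    by (metis U_ind_image blinfun_compose_assoc)
  also have "\<pi> (ind (\<alpha> ` D)) o\<^sub>L \<pi> one = \<pi> (ind (\<alpha> ` D))"
    unfolding pi_mult[OF Cfun_ind_image Cfun_one, symmetric]
    using one_mult[OF Cfun_ind_image] by (simp only: mult.commute)
  finally show ?thesis unfolding U_ind_image .
qed

lemma one_Us: "\<pi> one o\<^sub>L Us = Us"
proof -
  have "op_adjoint (\<pi> one) = \<pi> one" using pi_cnj[OF Cfun_one] by (simp add: if_distrib cong: if_cong)
  then show ?thesis
    using op_adjoint_compose[OF U_bounded pi_bounded[OF Cfun_one]] U_one by simp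
qed

lemma U_Us: "U o\<^sub>L Us = \<pi> (ind D)"
  using U_pi_Us[OF Cfun_one] unfolding U_one induced_endo_one .

section \<open>Iterates of \<delta> and products of the operators \<open>trm n a\<close>\<close>

abbreviation dpow :: "nat \<Rightarrow> ('a \<Rightarrow> complex) \<Rightarrow> 'a \<Rightarrow> complex" where
  "dpow k \<equiv> \<delta> ^^ k"

lemma Cfun_dpow: "a \<in> Cfun X \<Longrightarrow> dpow k a \<in> Cfun X"
  by (induction k) (auto intro: Cfun_induced_endo)

lemma dpow_cnj: "dpow k (\<lambda>x. cnj (a x)) = (\<lambda>x. cnj (dpow k a x))"
  by (induction k) (simp_all add: induced_endo_cnj)

lemma dpow_one: "dpow n one = ind (iter_domain X D \<alpha> n)"
  by (induction n) (auto simp: induced_endo_def)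

lemma dpow_ind_D: "dpow n (ind D) = ind (iter_domain X D \<alpha> (Suc n))"
  using dpow_one[of "Suc n"] unfolding funpow_Suc_right o_apply induced_endo_one .

text \<open>The first application of \<delta> reads a only on \<alpha>(D), where it vanishes. This
  is the source of the orthogonality between different terms of a normal form.\<close>

lemma dpow_eq_0:
  assumes "k > 0" "\<And>x. x \<in> \<alpha> ` D \<Longrightarrow> a x = 0" shows "dpow k a = (\<lambda>x. 0)"
proof -
  obtain j where j: "k = Suc j" using assms(1) gr0_conv_Suc by blast
  have "\<delta> a = (\<lambda>x. 0)" using assms(2) by (auto simp: induced_endo_def)
  moreover have "dpow j (\<lambda>x. 0) = (\<lambda>x. 0)" by (induction j) (simp_all add: induced_endo_zero)
  ultimately show ?thesis unfolding j funpow_Suc_right o_apply by simp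
qed

lemma iter_domain_antimono: "iter_domain X D \<alpha> (Suc n) \<subseteq> iter_domain X D \<alpha> n"
  using D_subset by (induction n) auto

definition trm :: "nat \<Rightarrow> ('a \<Rightarrow> complex) \<Rightarrow> ('h \<Rightarrow>\<^sub>L 'h)" where
  "trm n a = op_power Us n o\<^sub>L \<pi> a o\<^sub>L op_power U n"

lemma trm_0: "trm 0 a = \<pi> a"
  by (rule blinfun_eqI) (simp add: trm_def)

lemma trm_Suc: "trm (Suc n) a = Us o\<^sub>L trm n a o\<^sub>L U"
  using op_power_commute[of U n] by (simp add: trm_def blinfun_compose_assoc)

lemma trm_bounded: "a \<in> Cfun X \<Longrightarrow> trm n a \<in> bounded_operators"
  unfolding trm_def by (intro compose_bounded_operators op_power_bounded_operators Us_bounded U_bounded pi_bounded)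

lemma trm_add: "a \<in> Cfun X \<Longrightarrow> b \<in> Cfun X \<Longrightarrow> trm n (\<lambda>x. a x + b x) = trm n a + trm n b"
  by (simp add: trm_def pi_add blinfun_compose_distribs)

lemma trm_zero: "trm n (\<lambda>x. 0) = 0"
  by (simp add: trm_def pi_zero blinfun_compose_distribs)

lemma trm_scale: "a \<in> Cfun X \<Longrightarrow> trm n (\<lambda>x. c * a x) = op_scaleC c (trm n a)"
  by (simp add: trm_def pi_scale op_scaleC_compose_left op_scaleC_compose_right
      op_power_bounded_operators Us_bounded)

lemma trm_adjoint: "a \<in> Cfun X \<Longrightarrow> op_adjoint (trm n a) = trm n (\<lambda>x. cnj (a x))"
  unfolding trm_def
  by (simp add: op_adjoint_compose compose_bounded_operators op_power_bounded_operators Us_bounded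
      U_bounded pi_bounded pi_cnj op_adjoint_op_power op_adjoint_adjoint blinfun_compose_assoc)

lemma pi_Us_power:
  assumes "a \<in> Cfun X" shows "\<pi> a o\<^sub>L op_power Us k = op_power Us k o\<^sub>L \<pi> (dpow k a)"
  using assms
proof (induction k arbitrary: a)
  case 0
  show ?case by (rule blinfun_eqI) simp
next
  case (Suc k)
  have "\<pi> a o\<^sub>L op_power Us (Suc k) = Us o\<^sub>L (\<pi> (\<delta> a) o\<^sub>L op_power Us k)"
    using pi_Us[OF Suc.prems] by (simp add: blinfun_compose_assoc[symmetric])
  also have "\<dots> = op_power Us (Suc k) o\<^sub>L \<pi> (dpow (Suc k) a)"
    unfolding Suc.IH[OF Cfun_induced_endo[OF Suc.prems]] funpow_Suc_right o_apply
    by (simp add: blinfun_compose_assoc)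
  finally show ?case .
qed

lemma pi_trm:
  assumes "a \<in> Cfun X" "b \<in> Cfun X"
  shows "\<pi> a o\<^sub>L trm k b = trm k (\<lambda>x. dpow k a x * b x)"
proof -
  have "\<pi> a o\<^sub>L trm k b = (\<pi> a o\<^sub>L op_power Us k) o\<^sub>L (\<pi> b o\<^sub>L op_power U k)"
    by (simp add: trm_def blinfun_compose_assoc)
  also have "\<dots> = trm k (\<lambda>x. dpow k a x * b x)"
    unfolding pi_Us_power[OF assms(1)] trm_def pi_mult[OF Cfun_dpow[OF assms(1)] assms(2)]
    by (simp add: blinfun_compose_assoc)
  finally show ?thesis .
qed

text \<open>\<pi>(1) is a left unit for \<open>trm n c\<close>; moved past the powers of U^* it
  becomes \<delta>^n(1), the indicator of \<Delta>_n. So a coefficient counts only on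
  \<Delta>_n.\<close>

lemma trm_cut:
  assumes c: "c \<in> Cfun X"
  shows "trm n (\<lambda>x. dpow n one x * c x) = trm n c"
proof -
  have "\<pi> one o\<^sub>L trm n c = trm n c"
  proof (cases n)
    case 0
    then show ?thesis using pi_mult[OF Cfun_one c] one_mult[OF c] by (simp add: trm_0)
  next
    case (Suc m)
    then show ?thesis using one_Us by (simp add: trm_Suc blinfun_compose_assoc[symmetric])
  qed
  then show ?thesis using pi_trm[OF Cfun_one c, of n] by simp
qed

text \<open>Induction on n peels off one outer pair: the inner U U^* = \<pi>(1_D) is absorbed into b
  as \<delta>^m(1_D) with m = n + k, which is the indicator of \<Delta>_(m+1), and
  \<open>trm_cut\<close> removes it one level higher.\<close>

lemma trm_mult_le:
  assumes "a \<in> Cfun X" "b \<in> Cfun X"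
  shows "trm n a o\<^sub>L trm (n + k) b = trm (n + k) (\<lambda>x. dpow k a x * b x)"
  using assms(2)
proof (induction n arbitrary: b)
  case 0
  then show ?case using pi_trm[OF assms(1)] by (simp add: trm_0)
next
  case (Suc n)
  let ?m = "n + k"
  have ca: "dpow k a \<in> Cfun X" using assms(1) by (rule Cfun_dpow)
  have cb: "(\<lambda>x. dpow ?m (ind D) x * b x) \<in> Cfun X"
    using Cfun_mult[OF Cfun_dpow[OF Cfun_ind_D] Suc.prems] .
  have "trm (Suc n) a o\<^sub>L trm (Suc n + k) b
      = Us o\<^sub>L (trm n a o\<^sub>L ((U o\<^sub>L Us) o\<^sub>L trm ?m b)) o\<^sub>L U"
    by (simp add: trm_Suc blinfun_compose_assoc)
  also have "\<dots> = trm (Suc ?m) (\<lambda>x. dpow k a x * (dpow ?m (ind D) x * b x))"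
    unfolding U_Us pi_trm[OF Cfun_ind_D Suc.prems] Suc.IH[OF cb] trm_Suc ..
  also have "(\<lambda>x. dpow k a x * (dpow ?m (ind D) x * b x)) = (\<lambda>x. dpow (Suc ?m) one x * (dpow k a x * b x))"
    unfolding dpow_ind_D dpow_one by auto
  also have "trm (Suc ?m) \<dots> = trm (Suc ?m) (\<lambda>x. dpow k a x * b x)"
    by (rule trm_cut[OF Cfun_mult[OF ca Suc.prems]])
  finally show ?case by simp
qed

lemma trm_mult_ge:
  assumes a: "a \<in> Cfun X" and b: "b \<in> Cfun X"
  shows "trm (n + k) a o\<^sub>L trm n b = trm (n + k) (\<lambda>x. a x * dpow k b x)"
proof -
  have "trm (n + k) a o\<^sub>L trm n b = op_adjoint (trm n (\<lambda>x. cnj (b x)) o\<^sub>L trm (n + k) (\<lambda>x. cnj (a x)))"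
    using a b by (simp add: op_adjoint_compose trm_bounded Cfun_cnj trm_adjoint)
  also have "\<dots> = op_adjoint (trm (n + k) (\<lambda>x. cnj (dpow k b x) * cnj (a x)))"
    using trm_mult_le[OF Cfun_cnj[OF b] Cfun_cnj[OF a], of n k] by (simp add: dpow_cnj)
  also have "\<dots> = trm (n + k) (\<lambda>x. a x * dpow k b x)"
    using a b by (simp add: trm_adjoint Cfun_mult Cfun_cnj Cfun_dpow mult.commute)
  finally show ?thesis .
qed

text \<open>As i is idempotent, \<pi>(i c) = \<pi>(i) \<pi>(c) \<pi>(i), and each \<pi>(i) is U^*U.
  The inner U \<pi>(c) U^* is \<pi>(\<delta>(c)), leaving one more U^* and U outside.\<close>

lemma trm_push:
  assumes c: "c \<in> Cfun X"
  shows "trm n (\<lambda>x. ind (\<alpha> ` D) x * c x) = trm (Suc n) (\<delta> c)"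
proof -
  let ?i = "ind (\<alpha> ` D)"
  have "(\<lambda>x. ?i x * c x) = (\<lambda>x. ?i x * (c x * ?i x))" by auto
  then have "\<pi> (\<lambda>x. ?i x * c x) = \<pi> ?i o\<^sub>L (\<pi> c o\<^sub>L \<pi> ?i)"
    using pi_mult[OF Cfun_ind_image Cfun_mult[OF c Cfun_ind_image]] pi_mult[OF c Cfun_ind_image] by simp
  also have "\<dots> = Us o\<^sub>L (U o\<^sub>L \<pi> c o\<^sub>L Us) o\<^sub>L U"
    by (simp add: Us_U[symmetric] blinfun_compose_assoc)
  finally have "trm n (\<lambda>x. ?i x * c x) = op_power Us n o\<^sub>L (Us o\<^sub>L \<pi> (\<delta> c) o\<^sub>L U) o\<^sub>L op_power U n"
    unfolding U_pi_Us[OF c] by (simp add: trm_def)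
  also have "\<dots> = (op_power Us n o\<^sub>L Us) o\<^sub>L \<pi> (\<delta> c) o\<^sub>L (U o\<^sub>L op_power U n)"
    by (simp add: blinfun_compose_assoc)
  finally show ?thesis unfolding op_power_commute by (simp add: trm_def)
qed

text \<open>Multiplying \<open>trm (Suc n) d\<close> by U on the left and U^* on the right gives
  \<open>trm n d\<close> cut down on both sides to \<Delta>_(n+1), where d is supported. So the
  claim descends to level 0, where \<pi> is faithful.\<close>

lemma trm_eq_0:
  assumes "d \<in> Cfun X" "\<And>x. x \<notin> iter_domain X D \<alpha> n \<Longrightarrow> d x = 0" "trm n d = 0"
  shows "d = (\<lambda>x. 0)"
  using assms(2,3)
proof (induction n)
  case 0
  then show ?case using pi_inj assms(1) Cfun_zero pi_zero by (metis inj_onD trm_0)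
next
  case (Suc n)
  let ?i = "dpow n (ind D)"
  have i: "?i \<in> Cfun X" by (intro Cfun_dpow Cfun_ind_D)
  have eq: "(\<lambda>x. ?i x * d x) = d" "(\<lambda>x. d x * ?i x) = d"
    using Suc.prems(1) unfolding dpow_ind_D by auto
  have "0 = U o\<^sub>L trm (Suc n) d o\<^sub>L Us" unfolding Suc.prems(2) by (simp add: blinfun_compose_distribs)
  also have "\<dots> = (U o\<^sub>L Us) o\<^sub>L trm n d o\<^sub>L (U o\<^sub>L Us)" by (simp add: trm_Suc blinfun_compose_assoc)
  also have "\<dots> = trm (0 + n) d o\<^sub>L trm 0 (ind D)"
    unfolding U_Us pi_trm[OF Cfun_ind_D assms(1)] eq trm_0 by simp
  also have "\<dots> = trm n d" unfolding trm_mult_ge[OF assms(1) Cfun_ind_D] eq by simp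
  finally have "trm n d = 0" by simp
  moreover have "d x = 0" if "x \<notin> iter_domain X D \<alpha> n" for x
    using that iter_domain_antimono Suc.prems(1) by blast
  ultimately show ?case using Suc.IH by blast
qed

section \<open>Functions of the n-th coordinate on the extension\<close>

definition fterm :: "nat \<Rightarrow> ('a \<Rightarrow> complex) \<Rightarrow> (nat \<Rightarrow> 'a option) \<Rightarrow> complex" where
  "fterm n a = (\<lambda>x. if x \<in> ext_points X D \<alpha> then eval0 a (x n) else 0)"

lemma fterm_Cfun:
  assumes "a \<in> Cfun X" shows "fterm n a \<in> Cfun (alpha_extension X D \<alpha>)"
proof -
  have "continuous_map (alpha_extension X D \<alpha>) euclidean (\<lambda>x. eval0 a (x n))"
    using continuous_map_compose[OF continuous_map_ext_coordinate continuous_map_eval0[OF assms], of n]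
    by (simp add: o_def)
  then have "continuous_map (alpha_extension X D \<alpha>) euclidean (fterm n a)"
    by (rule continuous_map_eq) (simp add: fterm_def topspace_ext)
  then show ?thesis by (simp add: Cfun_def fterm_def topspace_ext)
qed

lemma fterm_add: "fterm n (\<lambda>x. a x + b x) = (\<lambda>x. fterm n a x + fterm n b x)"
  and fterm_scale: "fterm n (\<lambda>x. c * a x) = (\<lambda>x. c * fterm n a x)"
  and fterm_cnj: "fterm n (\<lambda>x. cnj (a x)) = (\<lambda>x. cnj (fterm n a x))"
  and fterm_zero: "fterm n (\<lambda>x. 0) = (\<lambda>x. 0)"
  by (auto simp: fterm_def eval0_def split: option.split)

lemma fterm_comp: "h 0 = 0 \<Longrightarrow> fterm n (\<lambda>x. h (a x)) x = h (fterm n a x)"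
  by (auto simp: fterm_def eval0_def split: option.split)

text \<open>Going down k coordinates of a chain applies \<alpha> k times, which is why \<delta>^k
  appears when functions of different coordinates are multiplied.\<close>

lemma eval0_dpow:
  assumes "x \<in> ext_points X D \<alpha>" "x (n + k) = Some v"
  shows "eval0 a (x n) = dpow k a v"
  using assms(2)
proof (induction k arbitrary: v)
  case 0
  then show ?case by (simp add: eval0_def)
next
  case (Suc k)
  then show ?case using ext_points_Some_Suc[OF assms(1), of "n + k" v] by (simp add: induced_endo_def)
qed

text \<open>Mirrors \<open>trm_mult_le\<close>; where the chain has stopped by index n + k, both
  sides vanish.\<close>

lemma fterm_mult: "fterm (n + k) (\<lambda>x. dpow k a x * b x) = (\<lambda>x. fterm n a x * fterm (n + k) b x)"
proof
  fix x
  show "fterm (n + k) (\<lambda>x. dpow k a x * b x) x = fterm n a x * fterm (n + k) b x"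
  proof (cases "x \<in> ext_points X D \<alpha>")
    case True
    then show ?thesis using eval0_dpow[OF True, of n k _ a]
      by (cases "x (n + k)") (auto simp: fterm_def eval0_def)
  qed (simp add: fterm_def)
qed

text \<open>A chain continues beyond index n exactly when its n-th coordinate lies in \<alpha>(D),
  and then that coordinate is the image of the next one.\<close>

lemma fterm_push: "fterm n (\<lambda>x. ind (\<alpha> ` D) x * c x) = fterm (Suc n) (\<delta> c)"
proof
  fix x
  show "fterm n (\<lambda>x. ind (\<alpha> ` D) x * c x) x = fterm (Suc n) (\<delta> c) x"
  proof (cases "x \<in> ext_points X D \<alpha>")
    case True
    then have "follows D \<alpha> (x n) (x (Suc n))" by (simp add: ext_points_def)
    then show ?thesis using True
      by (cases "x n"; cases "x (Suc n)") (auto simp: fterm_def eval0_def follows_def induced_endo_def)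
  qed (simp add: fterm_def)
qed

lemma fterm_cut: "fterm n (\<lambda>x. dpow n one x * c x) = fterm n c"
  unfolding dpow_one using ext_points_iter_domain[of _ X D \<alpha> n]
  by (auto simp: fterm_def eval0_def fun_eq_iff split: option.split)

text \<open>Single terms and sums suffice as generators: scalar multiples, products and adjoints of
  terms are again terms. Uniqueness of partners is not built in; it comes from
  \<open>gr_eq_0_iff\<close>.\<close>

inductive gr :: "((nat \<Rightarrow> 'a option) \<Rightarrow> complex) \<Rightarrow> ('h \<Rightarrow>\<^sub>L 'h) \<Rightarrow> bool" where
  gr_fterm: "a \<in> Cfun X \<Longrightarrow> gr (fterm n a) (trm n a)"
| gr_plus: "gr f R \<Longrightarrow> gr g S \<Longrightarrow> gr (\<lambda>x. f x + g x) (R + S)"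

lemma gr_scaleC: "gr f R \<Longrightarrow> gr (\<lambda>x. c * f x) (op_scaleC c R)"
proof (induction rule: gr.induct)
  case (gr_fterm a n)
  then show ?case using gr.gr_fterm[OF Cfun_scale[OF gr_fterm], of n c] by (simp add: fterm_scale trm_scale)
next
  case (gr_plus f R g S)
  then show ?case using gr.gr_plus by (simp add: distrib_left op_scaleC_add)
qed

lemma gr_imp_bounded: "gr f R \<Longrightarrow> R \<in> bounded_operators"
  by (induction rule: gr.induct) (auto intro: trm_bounded add_bounded_operators)

lemma gr_imp_Cfun: "gr f R \<Longrightarrow> f \<in> Cfun (alpha_extension X D \<alpha>)"
  by (induction rule: gr.induct) (auto intro: fterm_Cfun Cfun_add)

lemma gr_op_adjoint: "gr f R \<Longrightarrow> gr (\<lambda>x. cnj (f x)) (op_adjoint R)"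
proof (induction rule: gr.induct)
  case (gr_fterm a n)
  then show ?case using gr.gr_fterm[OF Cfun_cnj[OF gr_fterm], of n] by (simp add: fterm_cnj trm_adjoint)
next
  case (gr_plus f R g S)
  then show ?case using gr.gr_plus by (simp add: op_adjoint_add gr_imp_bounded)
qed

lemma gr_fterm_mult:
  assumes a: "a \<in> Cfun X" and b: "b \<in> Cfun X"
  shows "gr (\<lambda>x. fterm n a x * fterm m b x) (trm n a o\<^sub>L trm m b)"
proof (cases "n \<le> m")
  case True
  then obtain k where "m = n + k" using le_Suc_ex by blast
  then show ?thesis
    using gr_fterm[OF Cfun_mult[OF Cfun_dpow[OF a, of k] b], of m] trm_mult_le[OF a b, of n k] fterm_mult[of n k a b]
    by simp
next
  case False
  then obtain k where "n = m + k" using le_Suc_ex[of m n] by auto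
  then show ?thesis
    using gr_fterm[OF Cfun_mult[OF a Cfun_dpow[OF b, of k]], of n] trm_mult_ge[OF a b, of m k] fterm_mult[of m k b a]
    by (simp add: mult.commute)
qed

lemma gr_compose: "gr f R \<Longrightarrow> gr g S \<Longrightarrow> gr (\<lambda>x. f x * g x) (R o\<^sub>L S)"
proof (induction arbitrary: g S rule: gr.induct)
  case (gr_fterm a n)
  from gr_fterm(2,1) show ?case
  proof (induction rule: gr.induct)
    case (gr_fterm b m)
    then show ?case using gr_fterm_mult by blast
  next
    case (gr_plus g S g' S')
    then show ?case using gr.gr_plus by (simp add: distrib_left blinfun_compose_distribs)
  qed
next
  case (gr_plus f R f' R')
  then show ?case using gr.gr_plus[OF gr_plus.IH(1) gr_plus.IH(2)]
    by (simp add: distrib_right blinfun_compose_distribs)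
qed

lemma gr_sum:
  assumes "\<And>n. n < N \<Longrightarrow> a n \<in> Cfun X"
  shows "gr (\<lambda>x. \<Sum>n<N. fterm n (a n) x) (\<Sum>n<N. trm n (a n))"
  using assms
proof (induction N)
  case 0
  \<comment> \<open>\<open>gr\<close> has no clause for zero, so the empty sum is paired as the zero
    term at index 0.\<close>
  then show ?case using gr_fterm[OF Cfun_zero, of 0] by (simp add: fterm_zero trm_zero)
next
  case (Suc N)
  have "gr (\<lambda>x. \<Sum>n<N. fterm n (a n) x) (\<Sum>n<N. trm n (a n))" by (intro Suc) simp
  from gr_plus[OF this gr_fterm[OF Suc.prems[OF lessI]]] show ?case by simp
qed

text \<open>The terms of a normal sequence have disjoint supports on the extension: a point that continues
  beyond index \<open>n\<close> has its \<open>n\<close>-th coordinate in \<open>\<alpha> ` D\<close>.\<close>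

definition normal :: "nat \<Rightarrow> (nat \<Rightarrow> 'a \<Rightarrow> complex) \<Rightarrow> bool" where
  "normal N c \<longleftrightarrow> (\<forall>n\<le>N. c n \<in> Cfun X \<and> (\<forall>x. x \<notin> iter_domain X D \<alpha> n \<longrightarrow> c n x = 0)) \<and>
     (\<forall>n<N. \<forall>x\<in>\<alpha> ` D. c n x = 0)"

section \<open>Normal forms of finite sums\<close>

definition normal_form :: "nat \<Rightarrow> ((nat \<Rightarrow> 'a option) \<Rightarrow> complex) \<Rightarrow> ('h \<Rightarrow>\<^sub>L 'h) \<Rightarrow> bool" where
  "normal_form N f R \<longleftrightarrow> (\<exists>c. normal N c \<and> f = (\<lambda>x. \<Sum>n<Suc N. fterm n (c n) x) \<and>
     R = (\<Sum>n<Suc N. trm n (c n)))"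

text \<open>The part i c_N of the last coefficient lives on \<alpha>(D) and moves to index N + 1 as
  \<delta>(c_N); the rest vanishes on \<alpha>(D). The new last coefficient is again unrestricted on
  \<alpha>(D), so a form can be lengthened at will.\<close>

lemma normal_form_Suc:
  assumes "normal_form N f R" shows "normal_form (Suc N) f R"
proof -
  obtain c where c: "normal N c" and f: "f = (\<lambda>x. \<Sum>n<Suc N. fterm n (c n) x)" and R: "R = (\<Sum>n<Suc N. trm n (c n))"
    using assms unfolding normal_form_def by blast
  define i where "i = ind (\<alpha> ` D)"
  define j where "j = (\<lambda>x. one x + (-1) * i x)"
  define p where "p = (\<lambda>x. j x * c N x)"
  define q where "q = (\<lambda>x. i x * c N x)"
  define c' where "c' = c(N := p, Suc N := \<delta> (c N))"
  have cN: "c N \<in> Cfun X" using c by (simp add: normal_def)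
  have i: "i \<in> Cfun X" unfolding i_def by (rule Cfun_ind_image)
  have j: "j \<in> Cfun X" unfolding j_def by (rule Cfun_add[OF Cfun_one Cfun_scale[OF i]])
  have p: "p \<in> Cfun X" and q: "q \<in> Cfun X" unfolding p_def q_def by (rule Cfun_mult[OF j cN] Cfun_mult[OF i cN])+
  have pq: "c N = (\<lambda>x. p x + q x)"
    using one_mult[OF cN] by (auto simp: p_def q_def j_def algebra_simps fun_eq_iff)
  have fq: "fterm N q = fterm (Suc N) (\<delta> (c N))" and tq: "trm N q = trm (Suc N) (\<delta> (c N))"
    unfolding q_def i_def by (rule fterm_push) (rule trm_push[OF cN])
  have "normal (Suc N) c'"
    unfolding normal_def
  proof (intro conjI allI impI ballI)
    fix n assume "n \<le> Suc N"
    then show "c' n \<in> Cfun X" using c p Cfun_induced_endo[OF cN] by (auto simp: c'_def normal_def le_Suc_eq)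
  next
    fix n x assume "n \<le> Suc N" "x \<notin> iter_domain X D \<alpha> n"
    then show "c' n x = 0" using c
      by (auto simp: c'_def normal_def le_Suc_eq p_def induced_endo_def)
  next
    fix n x assume "n < Suc N" "x \<in> \<alpha> ` D"
    moreover have "j x = 0" if "x \<in> \<alpha> ` D" using that image_subset by (auto simp: j_def i_def)
    ultimately show "c' n x = 0" using c by (auto simp: c'_def normal_def less_Suc_eq p_def)
  qed
  moreover have "f = (\<lambda>x. \<Sum>n<Suc (Suc N). fterm n (c' n) x)"
  proof
    fix x
    have "fterm N (c N) x = fterm N p x + fterm (Suc N) (\<delta> (c N)) x"
      using arg_cong[OF pq, of "fterm N"] fq fterm_add[of N p q]
      by simp
    moreover have "(\<Sum>n<N. fterm n (c' n) x) = (\<Sum>n<N. fterm n (c n) x)"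
      by (intro sum.cong) (auto simp: c'_def)
    ultimately show "f x = (\<Sum>n<Suc (Suc N). fterm n (c' n) x)" by (simp add: f c'_def)
  qed
  moreover have "R = (\<Sum>n<Suc (Suc N). trm n (c' n))"
  proof -
    have "trm N (c N) = trm N p + trm (Suc N) (\<delta> (c N))"
      using arg_cong[OF pq, of "trm N"] tq trm_add[OF p q, of N]
      by simp
    moreover have "(\<Sum>n<N. trm n (c' n)) = (\<Sum>n<N. trm n (c n))"
      by (intro sum.cong) (auto simp: c'_def)
    ultimately show ?thesis by (simp add: R c'_def)
  qed
  ultimately show ?thesis unfolding normal_form_def by blast
qed

lemma normal_form_mono: "N \<le> M \<Longrightarrow> normal_form N f R \<Longrightarrow> normal_form M f R"
  by (induction M rule: dec_induct) (auto intro: normal_form_Suc)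

lemma normal_form_add:
  assumes "normal_form N f R" "normal_form N g S"
  shows "normal_form N (\<lambda>x. f x + g x) (R + S)"
proof -
  obtain c where c: "normal N c" "f = (\<lambda>x. \<Sum>n<Suc N. fterm n (c n) x)" "R = (\<Sum>n<Suc N. trm n (c n))"
    using assms(1) unfolding normal_form_def by blast
  obtain d where d: "normal N d" "g = (\<lambda>x. \<Sum>n<Suc N. fterm n (d n) x)" "S = (\<Sum>n<Suc N. trm n (d n))"
    using assms(2) unfolding normal_form_def by blast
  have "normal N (\<lambda>n x. c n x + d n x)" using c(1) d(1) by (auto simp: normal_def intro: Cfun_add)
  moreover have "(\<lambda>x. f x + g x) = (\<lambda>x. \<Sum>n<Suc N. fterm n (\<lambda>x. c n x + d n x) x)"
    unfolding c d fterm_add sum.distrib ..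
  moreover have "R + S = (\<Sum>n<Suc N. trm n (\<lambda>x. c n x + d n x))"
    unfolding c(3) d(3) sum.distrib[symmetric]
    using c(1) d(1) by (intro sum.cong) (auto simp: normal_def intro!: trm_add[symmetric])
  ultimately show ?thesis
    unfolding normal_form_def by (intro exI[of _ "\<lambda>n x. c n x + d n x"] conjI)
qed

text \<open>A single term, cut to its domain and preceded by zeros, is normal; the forms of two
  summands are lengthened to a common length before they are added.\<close>

lemma gr_normal_form: "gr f R \<Longrightarrow> \<exists>N. normal_form N f R"
proof (induction rule: gr.induct)
  case (gr_fterm a n)
  define b where "b = (\<lambda>x. dpow n one x * a x)"
  define c where "c = (\<lambda>m. if m = n then b else (\<lambda>x. 0))"
  have "b \<in> Cfun X" unfolding b_def by (rule Cfun_mult[OF Cfun_dpow[OF Cfun_one] gr_fterm])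
  then have "normal n c" by (auto simp: normal_def c_def Cfun_zero b_def dpow_one)
  moreover have "fterm n a = (\<lambda>x. \<Sum>m<Suc n. fterm m (c m) x)"
    using fterm_cut[of n a] by (simp add: c_def b_def fterm_zero)
  moreover have "trm n a = (\<Sum>m<Suc n. trm m (c m))"
    using trm_cut[OF gr_fterm, of n] by (simp add: c_def b_def trm_zero)
  ultimately show ?case unfolding normal_form_def by blast
next
  case (gr_plus f R g S)
  then obtain N M where "normal_form N f R" "normal_form M g S" by blast
  then have "normal_form (max N M) f R" "normal_form (max N M) g S"
    using normal_form_mono max.cobounded1 max.cobounded2 by blast+
  then show ?case using normal_form_add by blast
qed

lemma normal_disjoint:
  assumes c: "normal N c" and nm: "n < m" "m \<le> N"
  shows "fterm n (c n) x = 0 \<or> fterm m (c m) x = 0"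
proof (cases "x \<in> ext_points X D \<alpha> \<and> x m \<noteq> None")
  case True
  then have x: "x \<in> ext_points X D \<alpha>" ..
  have "x (Suc n) \<noteq> None"
    using ext_points_None_mono[OF x, of "Suc n" m] nm True by (intro notI) simp
  then obtain v where "x (Suc n) = Some v" by blast
  then have "v \<in> D" "x n = Some (\<alpha> v)" using ext_points_Some_Suc[OF x] by blast+
  then show ?thesis using c nm by (simp add: fterm_def eval0_def normal_def)
qed (auto simp: fterm_def eval0_def)

text \<open>Disjoint supports leave one nonzero summand, and \<open>h 0 = 0\<close> keeps the others
  zero. Taking the identity for h gives the value of the sum itself, so h passes through the
  sum.\<close>

lemma sum_single_term:
  assumes c: "normal N c" and k: "k \<le> N" "fterm k (c k) x \<noteq> 0" and h: "h 0 = (0::complex)"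
  shows "(\<Sum>n<Suc N. h (fterm n (c n) x)) = h (fterm k (c k) x)"
proof -
  have "fterm n (c n) x = 0" if "n \<le> N" "n \<noteq> k" for n
    using normal_disjoint[OF c, of n k x] normal_disjoint[OF c, of k n x] that k by (cases "n < k") auto
  then have "(\<Sum>n<Suc N. h (fterm n (c n) x)) = (\<Sum>n<Suc N. if n = k then h (fterm k (c k) x) else 0)"
    by (intro sum.cong) (auto simp: h)
  also have "\<dots> = h (fterm k (c k) x)" using k by simp
  finally show ?thesis .
qed

lemma gr_continuous_image:
  assumes "gr f R" "continuous_on UNIV h" "h 0 = 0"
  shows "\<exists>S. gr (\<lambda>x. h (f x)) S"
proof -
  obtain N c where c: "normal N c" and f: "f = (\<lambda>x. \<Sum>n<Suc N. fterm n (c n) x)"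
    using gr_normal_form[OF assms(1)] unfolding normal_form_def by blast
  have "h (f x) = (\<Sum>n<Suc N. fterm n (\<lambda>y. h (c n y)) x)" for x
  proof (cases "\<exists>k\<le>N. fterm k (c k) x \<noteq> 0")
    case True
    then obtain k where k: "k \<le> N" "fterm k (c k) x \<noteq> 0" by blast
    have "f x = fterm k (c k) x" unfolding f using sum_single_term[OF c k, of "\<lambda>z. z"] by simp
    then show ?thesis
      using sum_single_term[where h = h, OF c k assms(3)] by (simp add: fterm_comp[where h = h, OF assms(3)])
  next
    case False
    then show ?thesis by (simp add: f fterm_comp[where h = h, OF assms(3)] assms(3))
  qed
  moreover have "gr (\<lambda>x. \<Sum>n<Suc N. fterm n (\<lambda>y. h (c n y)) x) (\<Sum>n<Suc N. trm n (\<lambda>y. h (c n y)))"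
    using c by (intro gr_sum Cfun_comp[OF _ assms(2,3)]) (simp add: normal_def)
  ultimately show ?thesis by auto
qed

text \<open>The n-th coefficient is recovered from f by evaluation at a chain through a given point,
  and from R by multiplication with the adjoint of the n-th term, which annihilates all other
  terms.\<close>

lemma gr_eq_0_iff:
  assumes "gr f R" shows "(\<forall>x. f x = 0) \<longleftrightarrow> R = 0"
proof -
  obtain N c where c: "normal N c" and f: "f = (\<lambda>x. \<Sum>n<Suc N. fterm n (c n) x)"
    and R: "R = (\<Sum>n<Suc N. trm n (c n))"
    using gr_normal_form[OF assms] unfolding normal_form_def by blast
  have cC: "c n \<in> Cfun X" if "n \<le> N" for n using c that by (simp add: normal_def)
  have all0: "f = (\<lambda>x. 0) \<and> R = 0" if "\<forall>n\<le>N. c n = (\<lambda>x. 0)"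
    using that by (simp add: f R fterm_zero trm_zero)
  have "c n = (\<lambda>x. 0)" if f0: "\<forall>x. f x = 0" and n: "n \<le> N" for n
  proof (rule ccontr)
    assume "c n \<noteq> (\<lambda>x. 0)"
    then obtain v where v: "c n v \<noteq> 0" by blast
    then have "v \<in> iter_domain X D \<alpha> n" using c n by (auto simp: normal_def)
    then obtain x where "x \<in> ext_points X D \<alpha>" "x n = Some v" by (rule ex_ext_point[OF _ D_subset])
    then have fx: "fterm n (c n) x = c n v" by (simp add: fterm_def eval0_def)
    then have "f x = c n v" unfolding f using sum_single_term[OF c n, of x "\<lambda>z. z"] v by simp
    then show False using v f0 by simp
  qed
  moreover have "c n = (\<lambda>x. 0)" if R0: "R = 0" and n: "n \<le> N" for n
  proof -
    let ?a = "\<lambda>x. cnj (c n x)"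
    have a: "?a \<in> Cfun X" using cC[OF n] by (rule Cfun_cnj)
    \<comment> \<open>\<delta>^k, with k > 0 the difference of the indices, falls on the coefficient
      of smaller index; that one is not the last, so it vanishes on \<alpha>(D).\<close>
    have zero: "trm n ?a o\<^sub>L trm m (c m) = 0" if m: "m \<le> N" "m \<noteq> n" for m
    proof (cases "n < m")
      case True
      then obtain k where k: "m = n + k" "k > 0" using less_imp_add_positive by blast
      have "dpow k ?a = (\<lambda>x. 0)"
        by (rule dpow_eq_0[OF k(2)]) (use c True m in \<open>auto simp: normal_def\<close>)
      then show ?thesis using trm_mult_le[OF a cC[OF m(1)], of n k] by (simp add: k(1) trm_zero)
    next
      case False
      then obtain k where k: "n = m + k" "k > 0" using less_imp_add_positive[of m n] m by auto
      have "dpow k (c m) = (\<lambda>x. 0)"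
        by (rule dpow_eq_0[OF k(2)]) (use c False m n in \<open>auto simp: normal_def\<close>)
      then show ?thesis using trm_mult_ge[OF a cC[OF m(1)], of m k] by (simp add: k(1) trm_zero)
    qed
    have "0 = trm n ?a o\<^sub>L R" unfolding R0 by (simp add: blinfun_compose_distribs)
    also have "\<dots> = (\<Sum>m<Suc N. trm n ?a o\<^sub>L trm m (c m))"
      unfolding R by (rule bounded_bilinear.sum_right[OF bounded_bilinear_blinfun_compose])
    also have "\<dots> = (\<Sum>m<Suc N. if m = n then trm n ?a o\<^sub>L trm n (c n) else 0)"
      using zero by (intro sum.cong) auto
    also have "\<dots> = trm n ?a o\<^sub>L trm (n + 0) (c n)" using n by simp
    also have "\<dots> = trm n (\<lambda>x. cnj (c n x) * c n x)" unfolding trm_mult_le[OF a cC[OF n]] by simp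
    \<comment> \<open>|c n|^2 is supported on \<Delta>_n, so \<open>trm_eq_0\<close> makes it
      vanish, and c n with it.\<close>
    finally have "trm n (\<lambda>x. cnj (c n x) * c n x) = 0" by simp
    moreover have "cnj (c n x) * c n x = 0" if "x \<notin> iter_domain X D \<alpha> n" for x
      using c n that by (simp add: normal_def)
    ultimately have "(\<lambda>x. cnj (c n x) * c n x) = (\<lambda>x. 0)"
      using trm_eq_0[OF Cfun_mult[OF a cC[OF n]]] by blast
    then show ?thesis by (simp add: fun_eq_iff)
  qed
  ultimately show ?thesis using all0 by metis
qed

section \<open>Separation of points and the generated operator algebra\<close>

lemma gr_separates:
  assumes xy: "x \<in> ext_points X D \<alpha>" "y \<in> ext_points X D \<alpha>" "x \<noteq> y"
  shows "\<exists>f R. gr f R \<and> f x \<noteq> f y"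
proof -
  obtain n where n: "x n \<noteq> y n" using xy(3) by blast
  have inX: "v \<in> topspace X" if "z \<in> ext_points X D \<alpha>" "z n = Some v" for z v
    using ext_points_iter_domain[OF that] D_subset by (cases n) auto
  have "\<exists>a \<in> Cfun X. eval0 a (x n) \<noteq> eval0 a (y n)"
  proof (cases "x n = None \<or> y n = None")
    case True
    \<comment> \<open>The unit, which is 1 on X and 0 at the adjoined point, tells a chain that has
      stopped from one that goes on.\<close>
    then have "eval0 one (x n) \<noteq> eval0 one (y n)"
      using n inX xy by (auto simp: eval0_def split: option.split)
    then show ?thesis using Cfun_one by blast
  next
    case False
    then obtain u v where uv: "x n = Some u" "y n = Some v" by (cases "x n"; cases "y n") auto
    then obtain a where "a \<in> Cfun X" "a u \<noteq> a v"
      using ex_Cfun_separating[of u v] inX xy n by metis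
    then show ?thesis using uv by (auto simp: eval0_def)
  qed
  then obtain a where a: "a \<in> Cfun X" "eval0 a (x n) \<noteq> eval0 a (y n)" by blast
  then have "fterm n a x \<noteq> fterm n a y" using xy by (simp add: fterm_def)
  then show ?thesis using gr_fterm[OF a(1)] by blast
qed

lemma star_relation_gr: "star_relation (alpha_extension X D \<alpha>) gr"
proof
  \<comment> \<open>\<open>x 0\<close> is never the adjoined point, so the unit of C(X) read at
    coordinate 0 is the unit of the function algebra.\<close>
  have "fterm 0 one = (\<lambda>x. if x \<in> topspace (alpha_extension X D \<alpha>) then 1 else 0)"
    unfolding topspace_ext by (auto simp: fterm_def eval0_def ext_points_def fun_eq_iff)
  then show "\<exists>P. gr (\<lambda>x. if x \<in> topspace (alpha_extension X D \<alpha>) then 1 else 0) P"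
    using gr_fterm[OF Cfun_one, of 0] by auto
qed (fact gr_imp_Cfun gr_imp_bounded gr_plus gr_scaleC gr_compose gr_op_adjoint gr_continuous_image
    gr_eq_0_iff compact_space_ext gr_separates[folded topspace_ext])+

text \<open>The closure of the paired operators is already a C*-subalgebra; conversely any
  C*-subalgebra containing the generators contains their sums and the limits of those.\<close>

lemma cstar_generated_eq:
  "cstar_generated (\<Union>n. {trm n a | a. a \<in> Cfun X})
    = star_relation.image_alg gr"
proof -
  interpret star_relation "alpha_extension X D \<alpha>" gr by (rule star_relation_gr)
  let ?G = "\<Union>n. {trm n a | a. a \<in> Cfun X}"
  show ?thesis
  proof
    have "?G \<subseteq> {R. \<exists>f. gr f R}" using gr_fterm by blast
    also have "\<dots> \<subseteq> image_alg" unfolding image_alg_def by (rule closure_subset)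
    finally show "cstar_generated ?G \<subseteq> image_alg"
      unfolding cstar_generated_def using cstar_subalgebra_image_alg by blast
    show "image_alg \<subseteq> cstar_generated ?G"
      unfolding cstar_generated_def
    proof (intro Inter_greatest)
      fix B assume "B \<in> {B. cstar_subalgebra B \<and> ?G \<subseteq> B}"
      then have B: "cstar_subalgebra B" "?G \<subseteq> B" by blast+
      have "R \<in> B" if "gr f R" for f R
        using that
      proof (induction rule: gr.induct)
        case (gr_fterm a n)
        then show ?case using B(2) by blast
      next
        case (gr_plus f R g S)
        then show ?case using B(1) by (simp add: cstar_subalgebra_def)
      qed
      then show "image_alg \<subseteq> B"
        unfolding image_alg_def using B(1) by (intro closure_minimal) (auto simp: cstar_subalgebra_def)
    qed
  qed
qed

end

theorem theorem3p3:
  fixes X :: "'a topology" and \<Delta>\<^sub>1 :: "'a set" and \<alpha> :: "'a \<Rightarrow> 'a"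
    and \<pi> :: "('a \<Rightarrow> complex) \<Rightarrow> ('h::complex_hilbert_space \<Rightarrow>\<^sub>L 'h)"
    and U :: "'h \<Rightarrow>\<^sub>L 'h"
  assumes "partial_dynamical_system X \<Delta>\<^sub>1 \<alpha>"
    and "(\<pi>, U) \<in> CovFaithRep X \<Delta>\<^sub>1 \<alpha>"
  shows "\<exists>\<Phi>. star_isomorphism
           (cstar_generated
             (\<Union>n. {op_power (op_adjoint U) n o\<^sub>L \<pi> a o\<^sub>L op_power U n | a. a \<in> Cfun X}))
           (alpha_extension X \<Delta>\<^sub>1 \<alpha>) \<Phi> \<and>
         (\<forall>N (a :: nat \<Rightarrow> 'a \<Rightarrow> complex). (\<forall>n\<le>N. a n \<in> Cfun X) \<longrightarrow>
            (\<forall>x \<in> topspace (alpha_extension X \<Delta>\<^sub>1 \<alpha>).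
               \<Phi> (\<Sum>n\<le>N. op_power (op_adjoint U) n o\<^sub>L \<pi> (a n) o\<^sub>L op_power U n) x
               = (\<Sum>n\<le>N. eval0 (a n) (x n))))"
proof -
  interpret covariant_representation X \<Delta>\<^sub>1 \<alpha> \<pi> U
    using assms by unfold_locales
  interpret star_relation "alpha_extension X \<Delta>\<^sub>1 \<alpha>" gr by (rule star_relation_gr)
  obtain \<Phi> where \<Phi>: "star_isomorphism image_alg (alpha_extension X \<Delta>\<^sub>1 \<alpha>) \<Phi>"
    "\<And>f R. gr f R \<Longrightarrow> \<Phi> R = f"
    using star_isomorphism_image_alg by blast
  have "\<Phi> (\<Sum>n\<le>N. trm n (a n)) x = (\<Sum>n\<le>N. eval0 (a n) (x n))"
    if "\<forall>n\<le>N. a n \<in> Cfun X" "x \<in> topspace (alpha_extension X \<Delta>\<^sub>1 \<alpha>)" for N a x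
  proof -
    \<comment> \<open>The coefficients need not be normal: any such sum is paired with its function,
      and \<Phi> respects the pairing.\<close>
    have "gr (\<lambda>x. \<Sum>n<Suc N. fterm n (a n) x) (\<Sum>n<Suc N. trm n (a n))"
      using that(1) by (intro gr_sum) simp
    from \<Phi>(2)[OF this] that(2) show ?thesis
      by (simp add: lessThan_Suc_atMost fterm_def topspace_ext)
  qed
  then show ?thesis
    using \<Phi>(1) unfolding cstar_generated_eq[symmetric] trm_def by blast
qed

end
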